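(* Let $\mathscr D=([n],\mathcal J)$ be a nondegenerate discrete polymatroid, and let $\omega:[n]\to\mathbb R_{>0}$ be a positive weight function. Fix $1\le k<\mathrm{rk}(\mathscr D)$ and $0<t<1$. Then $$\mathrm J_{\omega,t}(k)^2\ =\ \Bigl(1+\frac1k\Bigr)\Bigl(1+\frac{1-t}{p(k-1)-1+t}\Bigr)\,\mathrm J_{\omega,t}(k-1)\,\mathrm J_{\omega,t}(k+1)$$ if and only if $k=1$, $\mathrm{polygirth}(\mathscr D)>2$, and $\omega$ is uniform (i.e. constant on $[n]$).
   Context: A discrete polymatroid $\mathscr D=([n],\mathcal J)$ consists of $[n]=\{1,\dots,n\}$ and a nonempty finite set $\mathcal J\subset\mathbb N^n$ (with $0\in\mathbb N$) such that: (hereditary) $a\in\mathcal J$, $b\in\mathbb N^n$, $b\le a$ componentwise imply $b\in\mathcal J$; (exchange) $a,b\in\mathcal J$, $|a|<|b|$ imply there is $i\in[n]$ with $a_i<b_i$ and $a+e_i\in\mathcal J$. Here $|a|=a_1+\dots+a_n$ and $e_1,\dots,e_n$ is the standard basis. $\mathrm{rk}(\mathscr D)=\max\{|a|:a\in\mathcal J\}$, $\mathcal J_k=\{a\in\mathcal J:|a|=k\}$, $\mathrm J(k)=|\mathcal J_k|$. $\mathscr D$ is nondegenerate if $e_i\in\mathcal J$ for every $i\in[n]$. Define $\mathrm{polygirth}(\mathscr D)=\min\{k:\mathrm J(k)<\binom{n+k-1}{k}\}$; thus every $a\in\mathbb N^n$ with $|a|<\mathrm{polygirth}(\mathscr D)$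 lies in $\mathcal J$. Put $\omega(a)=\prod_i\omega(i)^{a_i}$, $a!=\prod_i a_i!$, $\pi(a)=\sum_{i=1}^n\binom{a_i}{2}$, and $\mathrm J_{\omega,t}(k)=\sum_{a\in\mathcal J_k}t^{\pi(a)}\omega(a)/a!$. For $a\in\mathcal J$ let $\mathrm{Cont}(a)=\{i\in[n]:a+e_i\in\mathcal J\}$; for $i,j\in\mathrm{Cont}(a)$ write $i\sim_a j$ if $i=j$ or $a+e_i+e_j\notin\mathcal J$. This is an equivalence relation on $\mathrm{Cont}(a)$; $\mathrm{Par}(a)$ is the set of its equivalence classes. For $0\le k<\mathrm{rk}(\mathscr D)$, $p(k)=\max\{|\mathrm{Par}(a)|:a\in\mathcal J_k\}$.
   Formalization: The case n = 1 with k ≥ 2 is excluded by the added assumption "n ≥ 2 or k = 1": for n = 1, J = {0,…,r}, both sides are equal for every 1 ≤ k < r, so the stated equivalence fails for every such k ≥ 2. *)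

theory Defs
  imports Complex_Main "HOL-Library.Function_Algebras"
begin

text \<open>
  Elements of \<open>\<nat>\<^sup>n\<close> are functions of type \<^typ>\<open>nat \<Rightarrow> nat\<close> that vanish outside
  \<open>{1..n}\<close>; order and sum are pointwise.
\<close>

definition nat_vectors :: "nat \<Rightarrow> (nat \<Rightarrow> nat) set" where
  "nat_vectors n = {a. \<forall>i. i \<notin> {1..n} \<longrightarrow> a i = 0}"

definition unit_vec :: "nat \<Rightarrow> nat \<Rightarrow> nat" where
  "unit_vec i = (\<lambda>j. if j = i then 1 else 0)"

definition vec_size :: "nat \<Rightarrow> (nat \<Rightarrow> nat) \<Rightarrow> nat" where
  "vec_size n a = (\<Sum>i\<in>{1..n}. a i)"

definition discrete_polymatroid :: "nat \<Rightarrow> (nat \<Rightarrow> nat) set \<Rightarrow> bool" where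
  "discrete_polymatroid n J \<longleftrightarrow>
     J \<subseteq> nat_vectors n \<and> finite J \<and> J \<noteq> {} \<and>
     (\<forall>a\<in>J. \<forall>b\<in>nat_vectors n. b \<le> a \<longrightarrow> b \<in> J) \<and>
     (\<forall>a\<in>J. \<forall>b\<in>J. vec_size n a < vec_size n b \<longrightarrow>
        (\<exists>i\<in>{1..n}. a i < b i \<and> a + unit_vec i \<in> J))"

definition nondegenerate :: "nat \<Rightarrow> (nat \<Rightarrow> nat) set \<Rightarrow> bool" where
  "nondegenerate n J \<longleftrightarrow> (\<forall>i\<in>{1..n}. unit_vec i \<in> J)"

definition rk :: "nat \<Rightarrow> (nat \<Rightarrow> nat) set \<Rightarrow> nat" where
  "rk n J = Max (vec_size n ` J)"

definition level :: "nat \<Rightarrow> (nat \<Rightarrow> nat) set \<Rightarrow> nat \<Rightarrow> (nat \<Rightarrow> nat) set" where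
  "level n J k = {a \<in> J. vec_size n a = k}"

definition polygirth :: "nat \<Rightarrow> (nat \<Rightarrow> nat) set \<Rightarrow> nat" where
  "polygirth n J = (LEAST k. card (level n J k) < (n + k - 1) choose k)"

definition weight_monom :: "nat \<Rightarrow> (nat \<Rightarrow> real) \<Rightarrow> (nat \<Rightarrow> nat) \<Rightarrow> real" where
  "weight_monom n \<omega> a = (\<Prod>i\<in>{1..n}. \<omega> i ^ a i)"

definition vec_fact :: "nat \<Rightarrow> (nat \<Rightarrow> nat) \<Rightarrow> nat" where
  "vec_fact n a = (\<Prod>i\<in>{1..n}. fact (a i))"

definition pair_count :: "nat \<Rightarrow> (nat \<Rightarrow> nat) \<Rightarrow> nat" where
  "pair_count n a = (\<Sum>i\<in>{1..n}. a i choose 2)"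

definition weighted_level_sum ::
  "nat \<Rightarrow> (nat \<Rightarrow> nat) set \<Rightarrow> (nat \<Rightarrow> real) \<Rightarrow> real \<Rightarrow> nat \<Rightarrow> real" where
  "weighted_level_sum n J \<omega> t k =
     (\<Sum>a\<in>level n J k. t ^ pair_count n a * weight_monom n \<omega> a / real (vec_fact n a))"

definition Cont :: "nat \<Rightarrow> (nat \<Rightarrow> nat) set \<Rightarrow> (nat \<Rightarrow> nat) \<Rightarrow> nat set" where
  "Cont n J a = {i \<in> {1..n}. a + unit_vec i \<in> J}"

definition par_rel :: "nat \<Rightarrow> (nat \<Rightarrow> nat) set \<Rightarrow> (nat \<Rightarrow> nat) \<Rightarrow> (nat \<times> nat) set" where
  "par_rel n J a = {(i, j). i \<in> Cont n J a \<and> j \<in> Cont n J a \<and>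
     (i = j \<or> a + unit_vec i + unit_vec j \<notin> J)}"

definition Par :: "nat \<Rightarrow> (nat \<Rightarrow> nat) set \<Rightarrow> (nat \<Rightarrow> nat) \<Rightarrow> nat set set" where
  "Par n J a = Cont n J a // par_rel n J a"

definition max_par :: "nat \<Rightarrow> (nat \<Rightarrow> nat) set \<Rightarrow> nat \<Rightarrow> nat" where
  "max_par n J k = Max ((\<lambda>a. card (Par n J a)) ` level n J k)"

definition uniform_weight :: "nat \<Rightarrow> (nat \<Rightarrow> real) \<Rightarrow> bool" where
  "uniform_weight n \<omega> \<longleftrightarrow> (\<exists>c. \<forall>i\<in>{1..n}. \<omega> i = c)"

end

(* Let f_k be the generating polynomial of level k with coefficients t^pi(a) omega^a / a!, put p = p(k-1) and
   q = p/(p-1+t), and consider F = f_(k+1) + x_0 f_k + (q/2) x_0^2 f_(k-1). The inequality says that the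
   Hessian of F at (0,1,...,1) is negative semidefinite on the complement of (0,1,...,1)
   with respect to the Hessian itself. This holds for the
   derivative of F by any b of size k-1, where it is Cauchy-Schwarz over the parallel classes of b, and
   passes up to F through the derivatives of smaller order: for the matrix A of the variables other than x_0
   with row sums h, the local inequalities say P^2 >= P for the reversible Markov operator P = h^(-1) A, and
   since P is irreducible, its eigenvalues other than the top one are nonpositive.

   Equality yields a null vector (1,-c,...,-c) of the form at the top, which is then null for every b of size k-1.
   Hence omega(i) t^(b_i) is the same number for all such b and all i in Cont(b), and b + 2 e_i lies in J. For
   k >= 2 an exchange changes b_i while keeping i in Cont(b), which is impossible as t < 1. *)
theory Submission
  imports Defs "HOL-Analysis.Function_Topology"
begin

text \<open>The factor q is what completes a square. For |b| = k-1 rescale x_i by omega(i) t^(b_i)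
  and let S be the sum of the rescaled variables over Cont(b). Cauchy-Schwarz over at most p classes
  bounds the part without x_0 by (1 - (1-t)/p) S^2 = S^2/q, so up to a positive factor the whole
  form is at most (q x_0 + S)^2 / q, and a shift of the variables other than x_0 makes this vanish.
  The factor 1 + 1/k is (k-1)! (k+1)! / k!^2, left over because the iterated sums at level m carry a
  factor m!.

  The obstacle is x_0: the Markov operator involves only the other variables, so its nonpositive
  spectrum says nothing directly about the full form. The transfer moves a point along its rescaled
  gradient, and the bound it yields is not merely nonpositive but minus a weighted sum of squares of
  the linear forms one derivative further. That surplus is what lets a null vector descend.\<close>

section \<open>Spectral step for a reversible Markov operator\<close>

lemma quadratic_nonpos_linear_coeff:
  fixes a k :: real
  assumes "\<And>s. 2 * s * a + s\<^sup>2 * k \<le> 0"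
  shows "a \<le> 0"
proof (rule ccontr)
  assume "\<not> a \<le> 0"
  then have a: "a > 0" by simp
  define s where "s = a / (\<bar>k\<bar> + 1)"
  have s: "s > 0" using a by (simp add: s_def add_nonneg_pos)
  have "s * (2 * a + s * k) \<le> 0" using assms[of s] by (simp add: algebra_simps power2_eq_square)
  then have "2 * a + s * k \<le> 0" using s by (simp add: mult_le_0_iff)
  moreover have "s * \<bar>k\<bar> \<le> a" using a by (simp add: s_def field_simps)
  moreover have "- (s * \<bar>k\<bar>) \<le> s * k" using s by (metis abs_ge_minus_self abs_mult abs_of_pos minus_le_iff)
  ultimately show False using a by linarith
qed

text \<open>A single eigenvector suffices: a maximiser of the Rayleigh quotient on the complement of
  the constants. If its eigenvalue m is positive, \<open>star\<close> gives m <= m^2, hence m >= 1.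
  Its Dirichlet form is 2 - 2m <= 0, so it is constant along edges, constant by \<open>conn\<close>,
  and zero by orthogonality. Irreducibility is stated in \<open>conn\<close> in just the form that
  the Dirichlet argument uses.\<close>

lemma trickling_down:
  fixes A :: "nat \<Rightarrow> nat \<Rightarrow> real" and h x :: "nat \<Rightarrow> real"
  assumes fin: "finite L"
    and sym: "\<And>i j. A i j = A j i"
    and nonneg: "\<And>i j. A i j \<ge> 0"
    and h: "\<And>i. i \<in> L \<Longrightarrow> h i = (\<Sum>j\<in>L. A i j)"
    and hpos: "\<And>i. i \<in> L \<Longrightarrow> h i > 0"
    and conn: "\<And>y :: nat \<Rightarrow> real. (\<And>i j. i \<in> L \<Longrightarrow> j \<in> L \<Longrightarrow> A i j > 0 \<Longrightarrow> y i = y j)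
                 \<Longrightarrow> \<forall>i\<in>L. \<forall>j\<in>L. y i = y j"
    and star: "\<And>y :: nat \<Rightarrow> real. (\<Sum>i\<in>L. \<Sum>j\<in>L. y i * y j * A i j)
                 \<le> (\<Sum>i\<in>L. (\<Sum>j\<in>L. y j * A i j)\<^sup>2 / h i)"
    and orth: "(\<Sum>i\<in>L. h i * x i) = 0"
  shows "(\<Sum>i\<in>L. \<Sum>j\<in>L. x i * x j * A i j) \<le> 0"
proof (rule ccontr)
  define B where "B = (\<lambda>y z. \<Sum>i\<in>L. \<Sum>j\<in>L. y i * z j * A i j)"
  define N where "N = (\<lambda>y z. \<Sum>i\<in>L. h i * y i * z i)" for y z :: "nat \<Rightarrow> real"
  define l where "l = (\<lambda>y. \<Sum>i\<in>L. h i * y i)"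
  assume "\<not> ?thesis"
  then have Bx: "B x x > 0" by (simp add: B_def)
  have N_nonneg: "N y y \<ge> 0" for y
    unfolding N_def by (intro sum_nonneg) (simp add: hpos less_imp_le mult.assoc)
  have N_zero: "y i = 0" if "N y y \<le> 0" "i \<in> L" for y i
  proof -
    have "N y y = 0" using N_nonneg[of y] that by simp
    then have "h i * y i * y i = 0"
      unfolding N_def using fin that(2)
      by (subst (asm) sum_nonneg_eq_0_iff) (auto simp: hpos less_imp_le mult.assoc)
    then show ?thesis using hpos[OF that(2)] by auto
  qed
  have Bsym: "B y z = B z y" for y z
    unfolding B_def by (subst sum.swap) (simp add: sym mult.commute mult.left_commute)
  have B_add: "B (\<lambda>i. y i + s * z i) (\<lambda>i. y i + s * z i) = B y y + 2 * s * B y z + s\<^sup>2 * B z z" for y z s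
  proof -
    have "B (\<lambda>i. y i + s * z i) (\<lambda>i. y i + s * z i) = B y y + s * B y z + s * B z y + s\<^sup>2 * B z z"
      by (simp add: B_def algebra_simps sum.distrib sum_distrib_left power2_eq_square)
    then show ?thesis using Bsym[of z y] by simp
  qed
  have N_add: "N (\<lambda>i. y i + s * z i) (\<lambda>i. y i + s * z i) = N y y + 2 * s * N y z + s\<^sup>2 * N z z" for y z s
    by (simp add: N_def algebra_simps sum.distrib sum_distrib_left power2_eq_square)
  have l_add: "l (\<lambda>i. y i + s * z i) = l y + s * l z" for y z s
    by (simp add: l_def algebra_simps sum.distrib sum_distrib_left)
  have B_scale: "B (\<lambda>i. s * y i) (\<lambda>i. s * y i) = s\<^sup>2 * B y y" for s y
    by (simp add: B_def sum_distrib_left power2_eq_square algebra_simps)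
  have N_scale: "N (\<lambda>i. s * y i) (\<lambda>i. s * y i) = s\<^sup>2 * N y y" for s y
    by (simp add: N_def sum_distrib_left power2_eq_square algebra_simps)
  have l_scale: "l (\<lambda>i. s * y i) = s * l y" for s y
    by (simp add: l_def sum_distrib_left algebra_simps)
  \<comment> \<open>Coordinates outside \<open>L\<close> are pinned to zero; otherwise this unit
    sphere would not be compact in the product topology on functions.\<close>
  define S where "S = {y. (\<forall>i. i \<notin> L \<longrightarrow> y i = 0) \<and> l y = 0 \<and> N y y = 1}"
  define normalized where
    "normalized = (\<lambda>y i. (if i \<in> L then y i / sqrt (N y y) else 0))"
  have normalized: "normalized y \<in> S" "B (normalized y) (normalized y) = B y y / N y y"
    if "l y = 0" "N y y > 0" for y
  proof -
    let ?s = "1 / sqrt (N y y)"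
    have s: "?s\<^sup>2 = 1 / N y y" using that by (simp add: power_divide)
    have "l (normalized y) = l (\<lambda>i. ?s * y i)" "N (normalized y) (normalized y) = N (\<lambda>i. ?s * y i) (\<lambda>i. ?s * y i)"
      "B (normalized y) (normalized y) = B (\<lambda>i. ?s * y i) (\<lambda>i. ?s * y i)"
      by (simp_all add: normalized_def l_def N_def B_def)
    then show "normalized y \<in> S" "B (normalized y) (normalized y) = B y y / N y y"
      unfolding l_scale N_scale B_scale s using that by (auto simp: S_def normalized_def)
  qed
  have lx: "l x = 0" using orth by (simp add: l_def)
  have Nx: "N x x > 0"
  proof (rule ccontr)
    assume "\<not> N x x > 0"
    then have "\<forall>i\<in>L. x i = 0" using N_zero by force
    then have "B x x = 0" by (simp add: B_def)
    then show False using Bx by simp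
  qed
  have cont: "continuous_on UNIV (\<lambda>y :: nat \<Rightarrow> real. y i)" for i
    by (rule continuous_on_product_coordinates)
  \<comment> \<open>A crude radius common to all coordinates: \<open>N y y = 1\<close> gives y_i^2
    <= 1/h_i, and |u| <= u^2 + 1 avoids square roots.\<close>
  define R where "R = (\<Sum>i\<in>L. 1 / h i + 1)"
  define box where "box = Pi\<^sub>E UNIV (\<lambda>i. if i \<in> L then {- R..R} else {0::real})"
  have "compactin (product_topology (\<lambda>i::nat. euclidean) UNIV) box"
    unfolding box_def by (subst compactin_PiE) auto
  then have "compact box" by (simp add: euclidean_product_topology)
  have "S \<subseteq> box"
  proof
    fix y assume y: "y \<in> S"
    have "y i \<in> {-R..R}" if "i \<in> L" for i
    proof -
      have "h i * y i * y i \<le> N y y"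
        unfolding N_def using fin that
        by (intro member_le_sum) (auto simp: hpos less_imp_le mult.assoc)
      then have "(y i)\<^sup>2 \<le> 1 / h i" using y hpos[OF that] by (simp add: S_def field_simps power2_eq_square)
      moreover have "\<bar>y i\<bar> \<le> (y i)\<^sup>2 + 1"
        using zero_le_power2[of "\<bar>y i\<bar> - 1"] by (simp add: power2_diff)
      moreover have "1 / h i + 1 \<le> R"
        unfolding R_def using fin that hpos by (intro member_le_sum) (auto simp: less_imp_le add_nonneg_nonneg)
      ultimately show ?thesis by (simp add: abs_le_iff)
    qed
    then show "y \<in> box" using y by (auto simp: box_def S_def)
  qed
  moreover have "closed S"
  proof -
    have "S = (\<Inter>i\<in>-L. {y. y i = 0}) \<inter> {y. l y = 0} \<inter> {y. N y y = 1}" by (auto simp: S_def)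
    moreover have "closed {y. l y = 0}" "closed {y. N y y = 1}" "closed {y :: nat \<Rightarrow> real. y i = 0}" for i
      unfolding l_def N_def by (intro closed_Collect_eq continuous_intros cont)+
    ultimately show ?thesis by (auto intro!: closed_Int closed_INT)
  qed
  ultimately have "compact S" using \<open>compact box\<close> by (metis compact_Int_closed inf.absorb_iff2)
  moreover have "S \<noteq> {}" using normalized[OF lx Nx] by auto
  moreover have "continuous_on S (\<lambda>y. B y y)"
    unfolding B_def by (intro continuous_intros continuous_on_subset[OF cont]) auto
  ultimately obtain y where y: "y \<in> S" and ymax: "\<And>z. z \<in> S \<Longrightarrow> B z z \<le> B y y"
    using continuous_attains_sup[of S "\<lambda>y. B y y"] by blast
  define m where "m = B y y"
  have ly: "l y = 0" and Ny: "N y y = 1" using y by (auto simp: S_def)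
  have m: "m > 0"
  proof -
    have "B x x / N x x \<le> m" using ymax normalized[OF lx Nx] by (metis m_def)
    moreover have "B x x / N x x > 0" using Bx Nx by simp
    ultimately show ?thesis by simp
  qed
  have bound: "B z z \<le> m * N z z" if "l z = 0" for z
  proof (cases "N z z > 0")
    case True
    have "B z z / N z z \<le> m" using ymax normalized[OF that True] by (metis m_def)
    then show ?thesis using True by (simp add: field_simps)
  next
    case False
    then have "\<forall>i\<in>L. z i = 0" using N_zero by force
    then show ?thesis by (simp add: B_def N_def)
  qed
  \<comment> \<open>A maximiser of the Rayleigh quotient is an eigenvector; \<open>z\<close> is its defect.\<close>
  define z where "z = (\<lambda>i. (\<Sum>j\<in>L. y j * A i j) / h i - m * y i)"
  have hz: "h i * z i = (\<Sum>j\<in>L. y j * A i j) - m * (h i * y i)" if "i \<in> L" for i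
    using hpos[OF that] by (simp add: z_def field_simps)
  have lz: "l z = 0"
  proof -
    have "l z = (\<Sum>i\<in>L. \<Sum>j\<in>L. y j * A i j) - m * l y"
      by (simp add: l_def hz sum_subtractf sum_distrib_left)
    also have "(\<Sum>i\<in>L. \<Sum>j\<in>L. y j * A i j) = (\<Sum>j\<in>L. \<Sum>i\<in>L. y j * A j i)"
      by (subst sum.swap) (simp add: sym)
    also have "\<dots> = l y" by (simp add: l_def h sum_distrib_left mult.commute)
    finally show ?thesis using ly by simp
  qed
  have Byz: "B y z - m * N y z = N z z"
  proof -
    have "B y z = (\<Sum>i\<in>L. (\<Sum>j\<in>L. y j * A i j) * z i)"
      by (subst Bsym) (simp add: B_def sum_distrib_left sum_distrib_right algebra_simps)
    then have "B y z - m * N y z = (\<Sum>i\<in>L. ((\<Sum>j\<in>L. y j * A i j) - m * (h i * y i)) * z i)"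
      by (simp add: N_def sum_subtractf sum_distrib_left algebra_simps)
    also have "\<dots> = (\<Sum>i\<in>L. h i * z i * z i)" by (intro sum.cong) (simp_all add: hz)
    finally show ?thesis by (simp add: N_def)
  qed
  \<comment> \<open>First-order optimality in the direction of the defect itself, which is
    admissible because \<open>l z = 0\<close>; the linear coefficient is then exactly
    \<open>N z z\<close>.\<close>
  have "N z z \<le> 0"
  proof (rule quadratic_nonpos_linear_coeff)
    fix s
    have "l (\<lambda>i. y i + s * z i) = 0" using l_add ly lz by simp
    from bound[OF this] have "m + 2 * s * B y z + s\<^sup>2 * B z z \<le> m * (1 + 2 * s * N y z + s\<^sup>2 * N z z)"
      unfolding B_add N_add Ny m_def[symmetric] .
    then have "2 * s * (B y z - m * N y z) + s\<^sup>2 * (B z z - m * N z z) \<le> 0"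
      by (simp add: algebra_simps)
    then show "2 * s * N z z + s\<^sup>2 * (B z z - m * N z z) \<le> 0" unfolding Byz .
  qed
  then have eig: "(\<Sum>j\<in>L. y j * A i j) = m * (h i * y i)" if "i \<in> L" for i
    using N_zero[of z] hz[OF that] that by simp
  have "m \<le> (\<Sum>i\<in>L. (\<Sum>j\<in>L. y j * A i j)\<^sup>2 / h i)"
    unfolding m_def B_def by (rule star)
  also have "\<dots> = (\<Sum>i\<in>L. (m * (h i * y i))\<^sup>2 / h i)"
    by (intro sum.cong) (simp_all only: eig)
  also have "\<dots> = m\<^sup>2 * N y y"
    unfolding N_def sum_distrib_left using hpos
    by (intro sum.cong) (auto simp: power2_eq_square field_simps)
  finally have "m * 1 \<le> m * m" using Ny by (simp add: power2_eq_square)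
  then have "1 \<le> m" using m by simp
  have "(\<Sum>i\<in>L. \<Sum>j\<in>L. A i j * (y i - y j)\<^sup>2) = 2 * N y y - 2 * m"
  proof -
    have 1: "(\<Sum>i\<in>L. \<Sum>j\<in>L. A i j * (y i)\<^sup>2) = N y y"
      unfolding N_def by (intro sum.cong) (simp_all add: h sum_distrib_right power2_eq_square mult.assoc)
    have 2: "(\<Sum>i\<in>L. \<Sum>j\<in>L. A i j * (y j)\<^sup>2) = N y y"
      unfolding 1[symmetric] by (subst sum.swap) (simp add: sym)
    have "(\<Sum>i\<in>L. \<Sum>j\<in>L. A i j * (y i - y j)\<^sup>2) =
        (\<Sum>i\<in>L. \<Sum>j\<in>L. A i j * (y i)\<^sup>2) + (\<Sum>i\<in>L. \<Sum>j\<in>L. A i j * (y j)\<^sup>2) - 2 * B y y"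
      by (simp add: B_def power2_diff algebra_simps sum.distrib sum_subtractf sum_distrib_left)
    then show ?thesis using 1 2 by (simp add: m_def)
  qed
  then have "(\<Sum>i\<in>L. \<Sum>j\<in>L. A i j * (y i - y j)\<^sup>2) \<le> 0" using Ny \<open>1 \<le> m\<close> by simp
  then have "(\<Sum>i\<in>L. \<Sum>j\<in>L. A i j * (y i - y j)\<^sup>2) = 0"
    by (intro antisym sum_nonneg) (auto simp: nonneg)
  then have zero: "A i j * (y i - y j)\<^sup>2 = 0" if "i \<in> L" "j \<in> L" for i j
    using fin that by (simp add: sum_nonneg_eq_0_iff nonneg sum_nonneg)
  have const: "\<forall>i\<in>L. \<forall>j\<in>L. y i = y j"
  proof (rule conn)
    fix i j assume "i \<in> L" "j \<in> L" "A i j > 0"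
    then show "y i = y j" using zero[of i j] by simp
  qed
  have "y i = 0" if "i \<in> L" for i
  proof -
    have "l y = (\<Sum>j\<in>L. h j * y i)" unfolding l_def
      by (intro sum.cong refl) (metis const that)
    then have "(\<Sum>j\<in>L. h j) * y i = 0" using ly by (simp add: sum_distrib_right)
    moreover have "(\<Sum>j\<in>L. h j) > 0" using fin that hpos by (intro sum_pos) auto
    ultimately show ?thesis by simp
  qed
  then show False using Ny by (simp add: N_def)
qed

subsection \<open>Parallel classes\<close>

lemma vec_size_add_unit:
  "i \<in> {1..n} \<Longrightarrow> vec_size n (a + unit_vec i) = Suc (vec_size n a)"
  by (simp add: vec_size_def unit_vec_def sum.distrib)

locale polymatroid =
  fixes n :: nat and J :: "(nat \<Rightarrow> nat) set"
  assumes discrete_polymatroid: "discrete_polymatroid n J"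
begin

lemma in_vectors: "a \<in> J \<Longrightarrow> a \<in> nat_vectors n"
  and finite_J: "finite J"
  and J_nonempty: "J \<noteq> {}"
  using discrete_polymatroid by (auto simp: discrete_polymatroid_def)

lemma hereditary:
  assumes "a \<in> J" "b \<le> a" shows "b \<in> J"
proof -
  have "b \<in> nat_vectors n"
    unfolding nat_vectors_def
  proof (intro CollectI allI impI)
    fix i assume "i \<notin> {1..n}"
    then have "a i = 0" using in_vectors[OF assms(1)] by (simp add: nat_vectors_def)
    then show "b i = 0" using le_funD[OF assms(2), of i] by simp
  qed
  then show ?thesis using assms discrete_polymatroid unfolding discrete_polymatroid_def by blast
qed

lemma exchange:
  assumes "a \<in> J" "b \<in> J" "vec_size n a < vec_size n b"
  obtains i where "i \<in> {1..n}" "a i < b i" "a + unit_vec i \<in> J"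
proof -
  have "\<forall>a\<in>J. \<forall>b\<in>J. vec_size n a < vec_size n b \<longrightarrow> (\<exists>i\<in>{1..n}. a i < b i \<and> a + unit_vec i \<in> J)"
    using discrete_polymatroid unfolding discrete_polymatroid_def by (elim conjE)
  then show thesis using assms that by metis
qed

lemma add_unit_downward: "b + unit_vec i \<in> J \<Longrightarrow> b \<in> J"
  by (rule hereditary) (auto simp: le_fun_def)

lemma add_unit_downward2: "b + unit_vec i + unit_vec j \<in> J \<Longrightarrow> b + unit_vec j \<in> J"
  by (rule hereditary) (auto simp: le_fun_def)

lemma zero_in_J: "0 \<in> J"
  using J_nonempty hereditary by (metis all_not_in_conv le_fun_def zero_fun_apply zero_le)

lemma vec_size_eq_zero: "b \<in> J \<Longrightarrow> vec_size n b = 0 \<Longrightarrow> b = 0"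
  using in_vectors by (fastforce simp: vec_size_def nat_vectors_def)

lemma add_unit_index: "b + unit_vec i \<in> J \<Longrightarrow> i \<in> {1..n}"
  using in_vectors[of "b + unit_vec i"] by (force simp: nat_vectors_def unit_vec_def)

lemma mem_Cont: "i \<in> Cont n J b \<longleftrightarrow> b + unit_vec i \<in> J"
  using add_unit_index by (auto simp: Cont_def)

lemma Cont_subset: "Cont n J b \<subseteq> {1..n}" and finite_Cont: "finite (Cont n J b)"
  by (auto simp: Cont_def)

text \<open>A coordinate in which b + e_i + e_l exceeds b + e_j must be i or l. This one exchange
  gives the transitivity of parallelism, the singleton classes below and the connectivity of
  \<open>Cont\<close>.\<close>

lemma exchange_pair:
  assumes "b + unit_vec j \<in> J" "b + unit_vec i + unit_vec l \<in> J"
  shows "b + unit_vec j + unit_vec i \<in> J \<or> b + unit_vec j + unit_vec l \<in> J"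
proof -
  have "i \<in> {1..n}" "j \<in> {1..n}" "l \<in> {1..n}"
    using assms add_unit_index add_unit_downward by blast+
  then have "vec_size n (b + unit_vec j) < vec_size n (b + unit_vec i + unit_vec l)"
    by (simp only: vec_size_add_unit)
  then obtain x where x: "(b + unit_vec j) x < (b + unit_vec i + unit_vec l) x" "b + unit_vec j + unit_vec x \<in> J"
    using exchange assms by metis
  then have "x = i \<or> x = l" by (auto simp: unit_vec_def split: if_splits)
  then show ?thesis using x by auto
qed

lemma extend:
  assumes "b \<in> J" "vec_size n b < rk n J"
  obtains i where "i \<in> Cont n J b"
proof -
  obtain a where "a \<in> J" "vec_size n a = rk n J"
    using Max_in[of "vec_size n ` J"] finite_J J_nonempty unfolding rk_def by fastforce
  then show ?thesis using assms exchange[of b a] that mem_Cont by metis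
qed

lemma exists_of_size:
  assumes "b \<in> J" "vec_size n b \<le> m" "m \<le> rk n J"
  shows "\<exists>a\<in>J. b \<le> a \<and> vec_size n a = m"
  using assms(2,3)
proof (induction m rule: dec_induct)
  case base
  then show ?case using assms(1) by auto
next
  case (step m)
  then obtain a where a: "a \<in> J" "b \<le> a" "vec_size n a = m" by auto
  then obtain i where "i \<in> Cont n J a" using extend[of a] step by auto
  moreover then have "a + unit_vec i \<in> J" "i \<in> {1..n}"
    using mem_Cont add_unit_index by blast+
  moreover have "b \<le> a + unit_vec i" using a(2) by (auto simp: le_fun_def intro: le_add1 le_trans)
  ultimately show ?case using a(3) vec_size_add_unit by metis
qed

lemma equiv_par_rel: "equiv (Cont n J b) (par_rel n J b)"
proof (rule equivI)
  show "par_rel n J b \<subseteq> Cont n J b \<times> Cont n J b" by (auto simp: par_rel_def)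
  show "refl_on (Cont n J b) (par_rel n J b)" by (auto simp: refl_on_def par_rel_def)
  show "sym (par_rel n J b)" by (auto simp: sym_def par_rel_def add_ac)
  show "trans (par_rel n J b)"
  proof (rule transI)
    fix i j l
    assume "(i, j) \<in> par_rel n J b" "(j, l) \<in> par_rel n J b"
    then show "(i, l) \<in> par_rel n J b"
      using exchange_pair[of b j i l] by (auto simp: par_rel_def mem_Cont add_ac)
  qed
qed

lemma finite_Par: "finite (Par n J b)"
  unfolding Par_def using equiv_par_rel finite_Cont
  by (intro finite_quotient) (auto simp: par_rel_def)

lemma card_Par_pos:
  assumes "b \<in> J" "vec_size n b < rk n J"
  shows "card (Par n J b) > 0"
proof -
  obtain i where "i \<in> Cont n J b" using extend assms .
  then show ?thesis using finite_Par by (auto simp: card_gt_0_iff Par_def quotient_def)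
qed

lemma card_Par_le: "b \<in> J \<Longrightarrow> card (Par n J b) \<le> max_par n J (vec_size n b)"
  unfolding max_par_def by (intro Max_ge) (auto simp: level_def finite_J)

text \<open>Exchange with both added indices equal to i shows that i can be joined with every j in
  \<open>Cont\<close>. Hence the diagonal entries t of the local matrix occur only at singleton
  classes.\<close>

lemma parallel_class_singleton:
  assumes "b + unit_vec i + unit_vec i \<in> J"
  shows "{i} \<in> Par n J b"
proof -
  have i: "i \<in> Cont n J b" using assms add_unit_downward mem_Cont by blast
  have "par_rel n J b `` {i} = {i}"
    using i exchange_pair[of b _ i i] assms by (auto simp: par_rel_def mem_Cont add_ac)
  then show ?thesis using i unfolding Par_def by (metis quotientI)
qed

lemma sum_over_Par: "(\<Sum>P\<in>Par n J b. sum f P) = (\<Sum>i\<in>Cont n J b. f i)" for f :: "nat \<Rightarrow> real"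
proof -
  have "(\<Sum>P\<in>Par n J b. sum f P) = sum f (\<Union>(Par n J b))"
  proof (rule sum.Union_disjoint[symmetric, unfolded comp_def])
    show "\<forall>P\<in>Par n J b. finite P"
      using in_quotient_imp_subset[OF equiv_par_rel] finite_subset[OF _ finite_Cont]
      unfolding Par_def by blast
    show "\<forall>P\<in>Par n J b. \<forall>Q\<in>Par n J b. P \<noteq> Q \<longrightarrow> P \<inter> Q = {}"
      using quotient_disj[OF equiv_par_rel] by (auto simp: Par_def)
  qed
  then show ?thesis using equiv_par_rel by (simp add: Par_def Union_quotient)
qed

lemma sum_par_rel:
  "(\<Sum>i\<in>Cont n J b. z i * (\<Sum>j | (i, j) \<in> par_rel n J b. z j)) = (\<Sum>P\<in>Par n J b. (sum z P)\<^sup>2)"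
  for z :: "nat \<Rightarrow> real"
proof -
  have "(\<Sum>i\<in>P. z i * (\<Sum>j | (i, j) \<in> par_rel n J b. z j)) = (sum z P)\<^sup>2" if P: "P \<in> Par n J b" for P
  proof -
    have "{j. (i, j) \<in> par_rel n J b} = P" if "i \<in> P" for i
      using P that in_quotient_imp_closed[OF equiv_par_rel] in_quotient_imp_in_rel[OF equiv_par_rel]
      unfolding Par_def by blast
    then have "(\<Sum>i\<in>P. z i * (\<Sum>j | (i, j) \<in> par_rel n J b. z j)) = (\<Sum>i\<in>P. z i * sum z P)"
      by (intro sum.cong) auto
    then show ?thesis by (simp add: power2_eq_square sum_distrib_right)
  qed
  then show ?thesis
    using sum_over_Par[of "\<lambda>i. z i * (\<Sum>j | (i, j) \<in> par_rel n J b. z j)" b] by simp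
qed


text \<open>The matrix is all ones, minus the block indicator of the parallel classes, plus t on the
  diagonal at \<open>T\<close>. As each element of \<open>T\<close> is a class by itself, the
  diagonal part merges into the sum over classes: classes from \<open>T\<close> lose 1 - t, the
  others lose 1.\<close>

lemma parallel_form:
  fixes z :: "nat \<Rightarrow> real" and b :: "nat \<Rightarrow> nat"
  defines "T \<equiv> {i. b + unit_vec i + unit_vec i \<in> J}"
  shows "(\<Sum>i\<in>Cont n J b. \<Sum>j\<in>Cont n J b. z i * z j *
            (if b + unit_vec i + unit_vec j \<in> J then if i = j then t else 1 else 0)) =
         (sum z (Cont n J b))\<^sup>2 - (1 - t) * (\<Sum>P\<in>Par n J b. (sum z P)\<^sup>2)
           - t * (\<Sum>P\<in>Par n J b - (\<lambda>i. {i}) ` T. (sum z P)\<^sup>2)"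
proof -
  let ?C = "Cont n J b"
  have T: "T \<subseteq> ?C" unfolding T_def using add_unit_downward mem_Cont by blast
  have terms: "z i * z j * (if b + unit_vec i + unit_vec j \<in> J then if i = j then t else 1 else 0)
      = z i * z j - (if (i, j) \<in> par_rel n J b then z i * z j else 0) + (if i = j then if i \<in> T then t * (z i)\<^sup>2 else 0 else 0)"
    if "i \<in> ?C" "j \<in> ?C" for i j
    using that by (auto simp: par_rel_def T_def power2_eq_square)
  define Q where "Q = (\<Sum>i\<in>?C. \<Sum>j\<in>?C. z i * z j * (if b + unit_vec i + unit_vec j \<in> J then if i = j then t else 1 else 0))"
  have "Q = (\<Sum>i\<in>?C. \<Sum>j\<in>?C. z i * z j) - (\<Sum>i\<in>?C. \<Sum>j\<in>?C. if (i, j) \<in> par_rel n J b then z i * z j else 0)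
       + (\<Sum>i\<in>?C. \<Sum>j\<in>?C. if i = j then if i \<in> T then t * (z i)\<^sup>2 else 0 else 0)"
    unfolding Q_def sum.distrib[symmetric] sum_subtractf[symmetric] by (intro sum.cong refl terms)
  also have "(\<Sum>i\<in>?C. \<Sum>j\<in>?C. z i * z j) = (sum z ?C)\<^sup>2"
    by (simp add: power2_eq_square sum_product)
  also have "(\<Sum>i\<in>?C. \<Sum>j\<in>?C. if (i, j) \<in> par_rel n J b then z i * z j else 0)
      = (\<Sum>i\<in>?C. z i * (\<Sum>j | (i, j) \<in> par_rel n J b. z j))"
  proof (intro sum.cong refl)
    fix i assume "i \<in> ?C"
    have "{j. (i, j) \<in> par_rel n J b} = {j \<in> ?C. (i, j) \<in> par_rel n J b}" by (auto simp: par_rel_def)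
    then show "(\<Sum>j\<in>?C. if (i, j) \<in> par_rel n J b then z i * z j else 0) = z i * (\<Sum>j | (i, j) \<in> par_rel n J b. z j)"
      by (simp only: sum.inter_filter[OF finite_Cont] sum_distrib_left if_distrib mult_zero_right)
  qed
  also have "\<dots> = (\<Sum>P\<in>Par n J b. (sum z P)\<^sup>2)" by (rule sum_par_rel)
  also have "(\<Sum>i\<in>?C. \<Sum>j\<in>?C. if i = j then if i \<in> T then t * (z i)\<^sup>2 else 0 else 0) = t * (\<Sum>i\<in>T. (z i)\<^sup>2)"
  proof -
    have "(\<Sum>i\<in>?C. \<Sum>j\<in>?C. if i = j then if i \<in> T then t * (z i)\<^sup>2 else 0 else 0) = (\<Sum>i\<in>?C. if i \<in> T then t * (z i)\<^sup>2 else 0)"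
      using finite_Cont by (intro sum.cong) (simp_all add: sum.delta)
    also have "\<dots> = (\<Sum>i\<in>?C \<inter> T. t * (z i)\<^sup>2)" by (rule sum.inter_restrict[OF finite_Cont, symmetric])
    finally show ?thesis using T by (simp add: inf.absorb2 sum_distrib_left)
  qed
  also have "(\<Sum>i\<in>T. (z i)\<^sup>2) = (\<Sum>P\<in>(\<lambda>i. {i}) ` T. (sum z P)\<^sup>2)"
    by (subst sum.reindex) auto
  also have "\<dots> = (\<Sum>P\<in>Par n J b. (sum z P)\<^sup>2) - (\<Sum>P\<in>Par n J b - (\<lambda>i. {i}) ` T. (sum z P)\<^sup>2)"
  proof -
    have "(\<lambda>i. {i}) ` T \<subseteq> Par n J b" using parallel_class_singleton by (auto simp: T_def)
    then show ?thesis by (simp add: sum_diff finite_Par)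
  qed
  finally show ?thesis unfolding Q_def[symmetric] by (simp add: algebra_simps)
qed

end

section \<open>Weights and Cauchy-Schwarz over the parallel classes\<close>

text \<open>Cauchy-Schwarz with its deficit retained. The number of terms is only bounded by p,
  since p(k-1) is a maximum over many vectors; deviations are therefore taken from S/p rather than
  from the mean.\<close>

lemma sum_squares_deviation:
  fixes u :: "'a \<Rightarrow> real"
  assumes "finite A" "real (card A) \<le> p" "p > 0"
  shows "(\<Sum>x\<in>A. (u x - sum u A / p)\<^sup>2) + (sum u A)\<^sup>2 / p \<le> (\<Sum>x\<in>A. (u x)\<^sup>2)"
proof -
  let ?S = "sum u A"
  have "(\<Sum>x\<in>A. (u x - ?S / p)\<^sup>2) = (\<Sum>x\<in>A. (u x)\<^sup>2 - 2 * ?S / p * u x + (?S / p)\<^sup>2)"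
    by (intro sum.cong refl) (simp add: power2_eq_square algebra_simps)
  also have "\<dots> = (\<Sum>x\<in>A. (u x)\<^sup>2) - 2 * ?S / p * ?S + real (card A) * (?S / p)\<^sup>2"
    unfolding sum.distrib sum_subtractf sum_distrib_left[symmetric] by simp
  finally have "(\<Sum>x\<in>A. (u x - ?S / p)\<^sup>2) = (\<Sum>x\<in>A. (u x)\<^sup>2) - 2 * ?S\<^sup>2 / p + real (card A) * (?S / p)\<^sup>2"
    by (simp add: power2_eq_square)
  moreover have "real (card A) * (?S / p)\<^sup>2 \<le> p * (?S / p)\<^sup>2" using assms by (intro mult_right_mono) auto
  moreover have "p * (?S / p)\<^sup>2 = ?S\<^sup>2 / p" using assms by (simp add: power2_eq_square)
  ultimately show ?thesis by simp
qed

locale weighted_polymatroid = polymatroid +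
  fixes \<omega> :: "nat \<Rightarrow> real" and t :: real
  assumes weight_pos: "\<And>i. i \<in> {1..n} \<Longrightarrow> \<omega> i > 0"
    and t_pos: "0 < t" and t_less_1: "t < 1"
begin

text \<open>The factorials of the level sums are left out; they reappear as the number of orders in
  which a vector is built up from unit vectors.\<close>

definition weight :: "(nat \<Rightarrow> nat) \<Rightarrow> real" where
  "weight a = t ^ pair_count n a * weight_monom n \<omega> a"

lemma weight_gt_0: "weight a > 0"
  using t_pos weight_pos by (auto simp: weight_def weight_monom_def intro!: mult_pos_pos prod_pos)

text \<open>The factor that \<open>weight\<close> gains in the step from b to b + e_i; the exponent
  is the increment of the binomial coefficient of b_i over 2.\<close>

definition local_weight :: "(nat \<Rightarrow> nat) \<Rightarrow> nat \<Rightarrow> real" where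
  "local_weight b i = \<omega> i * t ^ b i"

lemma local_weight_pos: "i \<in> {1..n} \<Longrightarrow> local_weight b i > 0"
  using t_pos weight_pos by (simp add: local_weight_def)

lemma weight_add_unit:
  assumes "i \<in> {1..n}"
  shows "weight (b + unit_vec i) = weight b * local_weight b i"
proof -
  have "pair_count n (b + unit_vec i) = (\<Sum>j\<in>{1..n}. (b j choose 2) + (if j = i then b i else 0))"
    unfolding pair_count_def
    by (intro sum.cong) (auto simp: unit_vec_def numeral_2_eq_2)
  also have "\<dots> = pair_count n b + b i" using assms by (simp add: pair_count_def sum.distrib)
  finally have 1: "pair_count n (b + unit_vec i) = pair_count n b + b i" .
  have "weight_monom n \<omega> (b + unit_vec i) = (\<Prod>j\<in>{1..n}. \<omega> j ^ b j * (if j = i then \<omega> i else 1))"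
    unfolding weight_monom_def by (intro prod.cong) (auto simp: unit_vec_def)
  also have "\<dots> = weight_monom n \<omega> b * \<omega> i" using assms by (simp add: weight_monom_def prod.distrib)
  finally show ?thesis using 1 by (simp add: weight_def local_weight_def power_add)
qed

lemma weight_add_unit2:
  assumes "i \<in> {1..n}" "j \<in> {1..n}"
  shows "weight (b + unit_vec i + unit_vec j) =
    weight b * local_weight b i * local_weight b j * (if i = j then t else 1)"
  using assms by (simp add: weight_add_unit) (auto simp: local_weight_def unit_vec_def)

text \<open>The Hessian of the b-th derivative in the variables other than x_0, after rescaling by
  \<open>local_weight\<close> and division by \<open>weight b\<close>. The diagonal t arises because
  adding e_i twice costs one more factor t than two independent steps.\<close>

definition pair_form :: "(nat \<Rightarrow> nat) \<Rightarrow> (nat \<Rightarrow> real) \<Rightarrow> real" where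
  "pair_form b z = (\<Sum>i\<in>Cont n J b. \<Sum>j\<in>Cont n J b. z i * z j *
     (if b + unit_vec i + unit_vec j \<in> J then if i = j then t else 1 else 0))"

text \<open>Both nonnegative terms beside \<open>pair_form\<close> could be dropped for the
  inequality, but in the case of equality they vanish and reveal the structure of the
  classes.\<close>

lemma pair_form_bound:
  fixes z :: "nat \<Rightarrow> real" and b :: "nat \<Rightarrow> nat"
  assumes "real (card (Par n J b)) \<le> p" "p > 0"
  defines "S \<equiv> sum z (Cont n J b)"
  shows "pair_form b z + (1 - t) * (\<Sum>P\<in>Par n J b. (sum z P - S / p)\<^sup>2)
         + t * (\<Sum>P\<in>Par n J b - (\<lambda>i. {i}) ` {i. b + unit_vec i + unit_vec i \<in> J}. (sum z P)\<^sup>2)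
         \<le> (1 - (1 - t) / p) * S\<^sup>2"
proof -
  have S: "S = (\<Sum>P\<in>Par n J b. sum z P)" by (simp add: S_def sum_over_Par)
  have "(1 - t) * ((\<Sum>P\<in>Par n J b. (sum z P - S / p)\<^sup>2) + S\<^sup>2 / p) \<le> (1 - t) * (\<Sum>P\<in>Par n J b. (sum z P)\<^sup>2)"
    unfolding S using t_less_1 by (intro mult_left_mono sum_squares_deviation finite_Par assms) auto
  then show ?thesis unfolding pair_form_def parallel_form S_def[symmetric] by (simp add: algebra_simps)
qed

end

subsection \<open>Hessian forms\<close>

text \<open>With these rules the simplifier turns an eta-expanded \<open>b + unit_vec i\<close> into a pointwise sum that no lemma matches.\<close>

declare plus_fun_apply [simp del] zero_fun_apply [simp del]

context weighted_polymatroid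
begin

text \<open>
  \<open>ext_sum m b\<close> is the \<open>b\<close>-th partial derivative at \<open>(1, \<dots>, 1)\<close> of the generating polynomial of
  level \<open>|b| + m\<close>, times \<open>m!\<close>. In \<open>quad\<close> and \<open>lin\<close>, index \<open>0\<close> is the auxiliary variable \<open>x\<^sub>0\<close> of the
  polynomial described at the top, and \<open>q\<close> the factor in front of \<open>x\<^sub>0\<^sup>2/2\<close>; \<open>lin\<close> is the polarisation
  of \<open>quad\<close> against the vector that is \<open>0\<close> at index \<open>0\<close> and \<open>1\<close> elsewhere.
\<close>

primrec ext_sum :: "nat \<Rightarrow> (nat \<Rightarrow> nat) \<Rightarrow> real" where
  "ext_sum 0 b = (if b \<in> J then weight b else 0)"
| "ext_sum (Suc m) b = (\<Sum>i\<in>{1..n}. ext_sum m (b + unit_vec i))"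

definition quad :: "real \<Rightarrow> nat \<Rightarrow> (nat \<Rightarrow> nat) \<Rightarrow> (nat \<Rightarrow> real) \<Rightarrow> real" where
  "quad q r b x = q * (x 0)\<^sup>2 * ext_sum r b
     + 2 * x 0 * (\<Sum>i\<in>{1..n}. x i * ext_sum r (b + unit_vec i))
     + (\<Sum>i\<in>{1..n}. \<Sum>j\<in>{1..n}. x i * x j * ext_sum r (b + unit_vec i + unit_vec j))"

definition lin :: "nat \<Rightarrow> (nat \<Rightarrow> nat) \<Rightarrow> (nat \<Rightarrow> real) \<Rightarrow> real" where
  "lin r b x = x 0 * ext_sum (Suc r) b + (\<Sum>i\<in>{1..n}. x i * ext_sum (Suc r) (b + unit_vec i))"

lemma ext_sum_nonneg: "ext_sum m b \<ge> 0"
  by (induction m arbitrary: b) (auto intro!: sum_nonneg simp: weight_gt_0 less_imp_le)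

lemma ext_sum_eq_zero: "b \<notin> J \<Longrightarrow> ext_sum m b = 0"
proof (induction m arbitrary: b)
  case (Suc m)
  then have "b + unit_vec i \<notin> J" for i using add_unit_downward by blast
  then show ?case unfolding ext_sum.simps by (intro sum.neutral ballI Suc.IH)
qed simp

lemma ext_sum_pos: "b \<in> J \<Longrightarrow> vec_size n b + m \<le> rk n J \<Longrightarrow> ext_sum m b > 0"
proof (induction m arbitrary: b)
  case (Suc m)
  then obtain i where i: "i \<in> Cont n J b" using extend[of b] by auto
  then have bi: "b + unit_vec i \<in> J" "i \<in> {1..n}" using mem_Cont add_unit_index by blast+
  have "ext_sum m (b + unit_vec i) > 0"
  proof (rule Suc.IH)
    show "vec_size n (b + unit_vec i) + m \<le> rk n J"
      using Suc.prems(2) vec_size_add_unit[OF bi(2), of b] by simp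
  qed (rule bi)
  with bi(2) show ?case
    unfolding ext_sum.simps by (intro sum_pos2[of _ i]) (auto simp: ext_sum_nonneg)
qed (simp add: weight_gt_0)

text \<open>Euler's identity, here and for \<open>quad\<close>: the base point (0,1,...,1) has no
  component along x_0, so only derivatives in the directions 1 to n enter.\<close>

lemma lin_Suc: "lin (Suc r) b x = (\<Sum>i\<in>{1..n}. lin r (b + unit_vec i) x)"
proof -
  have "(\<Sum>i\<in>{1..n}. x i * ext_sum (Suc (Suc r)) (b + unit_vec i))
      = (\<Sum>l\<in>{1..n}. \<Sum>i\<in>{1..n}. x i * ext_sum (Suc r) (b + unit_vec l + unit_vec i))"
    by (subst sum.swap) (simp add: sum_distrib_left add_ac)
  then show ?thesis
    by (simp only: lin_def sum.distrib ext_sum.simps(2)[of "Suc r" b] sum_distrib_left)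
qed

lemma quad_Suc: "quad q (Suc r) b x = (\<Sum>i\<in>{1..n}. quad q r (b + unit_vec i) x)"
proof -
  have 1: "(\<Sum>i\<in>{1..n}. x i * ext_sum (Suc r) (b + unit_vec i))
      = (\<Sum>l\<in>{1..n}. \<Sum>i\<in>{1..n}. x i * ext_sum r (b + unit_vec l + unit_vec i))"
    by (subst sum.swap) (simp add: sum_distrib_left add_ac)
  have "(\<Sum>i\<in>{1..n}. \<Sum>j\<in>{1..n}. x i * x j * ext_sum (Suc r) (b + unit_vec i + unit_vec j))
      = (\<Sum>i\<in>{1..n}. \<Sum>l\<in>{1..n}. \<Sum>j\<in>{1..n}. x i * x j * ext_sum r (b + unit_vec l + unit_vec i + unit_vec j))"
    by (subst sum.swap) (simp add: sum_distrib_left add_ac)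
  also have "\<dots> = (\<Sum>l\<in>{1..n}. \<Sum>i\<in>{1..n}. \<Sum>j\<in>{1..n}. x i * x j * ext_sum r (b + unit_vec l + unit_vec i + unit_vec j))"
    by (rule sum.swap)
  finally show ?thesis
    by (simp only: quad_def sum.distrib 1 ext_sum.simps(2)[of r b] sum_distrib_left)
qed

lemma quad_add:
  assumes "z 0 = 0"
  shows "quad q r b (\<lambda>i. x i + z i) = quad q r b x
      + 2 * (\<Sum>i\<in>{1..n}. z i * (x 0 * ext_sum r (b + unit_vec i) + (\<Sum>j\<in>{1..n}. x j * ext_sum r (b + unit_vec i + unit_vec j))))
      + (\<Sum>i\<in>{1..n}. \<Sum>j\<in>{1..n}. z i * z j * ext_sum r (b + unit_vec i + unit_vec j))"
proof -
  let ?A = "\<lambda>i j. ext_sum r (b + unit_vec i + unit_vec j)"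
  have "(\<Sum>i\<in>{1..n}. \<Sum>j\<in>{1..n}. (x i + z i) * (x j + z j) * ?A i j)
      = (\<Sum>i\<in>{1..n}. \<Sum>j\<in>{1..n}. x i * x j * ?A i j) + (\<Sum>i\<in>{1..n}. \<Sum>j\<in>{1..n}. z i * z j * ?A i j)
      + (\<Sum>i\<in>{1..n}. \<Sum>j\<in>{1..n}. z i * x j * ?A i j) + (\<Sum>i\<in>{1..n}. \<Sum>j\<in>{1..n}. x i * z j * ?A i j)"
    unfolding sum.distrib[symmetric] by (intro sum.cong refl) (simp add: algebra_simps)
  also have "(\<Sum>i\<in>{1..n}. \<Sum>j\<in>{1..n}. x i * z j * ?A i j) = (\<Sum>i\<in>{1..n}. \<Sum>j\<in>{1..n}. z i * x j * ?A i j)"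
    by (subst sum.swap) (simp add: add_ac mult_ac)
  finally have 1: "(\<Sum>i\<in>{1..n}. \<Sum>j\<in>{1..n}. (x i + z i) * (x j + z j) * ?A i j)
      = (\<Sum>i\<in>{1..n}. \<Sum>j\<in>{1..n}. x i * x j * ?A i j) + (\<Sum>i\<in>{1..n}. \<Sum>j\<in>{1..n}. z i * z j * ?A i j)
      + 2 * (\<Sum>i\<in>{1..n}. \<Sum>j\<in>{1..n}. z i * x j * ?A i j)" by simp
  have 2: "(\<Sum>i\<in>{1..n}. (x i + z i) * ext_sum r (b + unit_vec i))
     = (\<Sum>i\<in>{1..n}. x i * ext_sum r (b + unit_vec i)) + (\<Sum>i\<in>{1..n}. z i * ext_sum r (b + unit_vec i))"
    unfolding sum.distrib[symmetric] by (intro sum.cong refl) (simp add: algebra_simps)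
  have 3: "(\<Sum>i\<in>{1..n}. z i * (x 0 * ext_sum r (b + unit_vec i) + (\<Sum>j\<in>{1..n}. x j * ?A i j)))
     = x 0 * (\<Sum>i\<in>{1..n}. z i * ext_sum r (b + unit_vec i)) + (\<Sum>i\<in>{1..n}. \<Sum>j\<in>{1..n}. z i * x j * ?A i j)"
    by (simp only: distrib_left sum.distrib sum_distrib_left mult.assoc mult.left_commute[of "x 0"])
  show ?thesis unfolding quad_def 1 2 3 using assms by (simp add: algebra_simps)
qed

text \<open>The point is the linear term: half the gradient of \<open>quad\<close> at b in direction
  i is \<open>lin\<close> at b + e_i, the very quantity on the right of the local
  inequality.\<close>

lemma quad_Suc_add:
  assumes "z 0 = 0"
  shows "quad q (Suc r) b (\<lambda>i. x i + z i) = quad q (Suc r) b x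
      + 2 * (\<Sum>i\<in>{1..n}. z i * lin r (b + unit_vec i) x)
      + (\<Sum>i\<in>{1..n}. \<Sum>j\<in>{1..n}. z i * z j * ext_sum (Suc r) (b + unit_vec i + unit_vec j))"
  unfolding lin_def by (rule quad_add[where z = z, OF assms])

lemma lin_add:
  assumes "z 0 = 0"
  shows "lin r b (\<lambda>i. x i + z i) = lin r b x + (\<Sum>i\<in>{1..n}. z i * ext_sum (Suc r) (b + unit_vec i))"
  using assms by (simp add: lin_def sum.distrib algebra_simps del: ext_sum.simps)

text \<open>Translation along (0,1,...,1), the direction whose polarisation is \<open>lin\<close>; a
  suitable s projects onto the kernel of \<open>lin\<close>.\<close>

definition shift :: "real \<Rightarrow> (nat \<Rightarrow> real) \<Rightarrow> nat \<Rightarrow> real" where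
  "shift s x = (\<lambda>i. x i + (if i = 0 then 0 else - s))"

lemma quad_shift:
  "quad q r b (shift s x) = quad q r b x - 2 * s * lin r b x + s\<^sup>2 * ext_sum (r + 2) b"
proof -
  let ?z = "\<lambda>i::nat. if i = 0 then 0 else - s"
  have z: "?z i = - s" if "i \<in> {1..n}" for i using that by auto
  have "(\<Sum>i\<in>{1..n}. ?z i * (x 0 * ext_sum r (b + unit_vec i) + (\<Sum>j\<in>{1..n}. x j * ext_sum r (b + unit_vec i + unit_vec j))))
     = (\<Sum>i\<in>{1..n}. - s * (x 0 * ext_sum r (b + unit_vec i) + (\<Sum>j\<in>{1..n}. x j * ext_sum r (b + unit_vec i + unit_vec j))))"
    by (intro sum.cong) (auto simp: z)
  also have "\<dots> = - s * (x 0 * (\<Sum>i\<in>{1..n}. ext_sum r (b + unit_vec i)) + (\<Sum>i\<in>{1..n}. \<Sum>j\<in>{1..n}. x j * ext_sum r (b + unit_vec i + unit_vec j)))"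
    by (simp only: sum_distrib_left[symmetric] sum.distrib)
  also have "(\<Sum>i\<in>{1..n}. \<Sum>j\<in>{1..n}. x j * ext_sum r (b + unit_vec i + unit_vec j)) = (\<Sum>i\<in>{1..n}. x i * ext_sum (Suc r) (b + unit_vec i))"
    by (subst sum.swap) (simp add: sum_distrib_left add_ac)
  finally have 1: "(\<Sum>i\<in>{1..n}. ?z i * (x 0 * ext_sum r (b + unit_vec i) + (\<Sum>j\<in>{1..n}. x j * ext_sum r (b + unit_vec i + unit_vec j))))
     = - s * lin r b x" by (simp add: lin_def)
  have "(\<Sum>i\<in>{1..n}. \<Sum>j\<in>{1..n}. ?z i * ?z j * ext_sum r (b + unit_vec i + unit_vec j))
     = (\<Sum>i\<in>{1..n}. \<Sum>j\<in>{1..n}. s\<^sup>2 * ext_sum r (b + unit_vec i + unit_vec j))"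
    by (intro sum.cong) (auto simp: z power2_eq_square)
  also have "\<dots> = s\<^sup>2 * ext_sum (r + 2) b" by (simp add: sum_distrib_left numeral_2_eq_2)
  finally show ?thesis unfolding shift_def by (subst quad_add) (simp_all only: 1 if_True, simp)
qed

lemma lin_shift: "lin r b (shift s x) = lin r b x - s * ext_sum (r + 2) b"
proof -
  have "lin r b (shift s x) = lin r b x + (\<Sum>i\<in>{1..n}. (if i = 0 then 0 else - s) * ext_sum (Suc r) (b + unit_vec i))"
    unfolding shift_def by (rule lin_add) simp
  also have "(\<Sum>i\<in>{1..n}. (if i = 0 then 0 else - s) * ext_sum (Suc r) (b + unit_vec i))
     = (\<Sum>i\<in>{1..n}. - s * ext_sum (Suc r) (b + unit_vec i))"
    by (intro sum.cong) auto
  finally show ?thesis by (simp add: sum_distrib_left[symmetric] sum_negf numeral_2_eq_2)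
qed

text \<open>As a polynomial in s, the shifted form has leading coefficient
  \<open>ext_sum (r + 2) b\<close>, which is nonnegative. A single nonpositive value therefore makes
  the discriminant nonnegative, so s need not be the projecting shift.\<close>

lemma reverse_Cauchy_Schwarz:
  assumes "quad q r b (shift s x) \<le> 0"
  shows "ext_sum (r + 2) b * quad q r b x \<le> (lin r b x)\<^sup>2"
proof -
  let ?m = "ext_sum (r + 2) b" and ?l = "lin r b x"
  have "quad q r b x \<le> 2 * s * ?l - s\<^sup>2 * ?m" using assms by (simp add: quad_shift)
  then have "?m * quad q r b x \<le> ?m * (2 * s * ?l - s\<^sup>2 * ?m)"
    by (intro mult_left_mono ext_sum_nonneg)
  also have "\<dots> = ?l\<^sup>2 - (?l - s * ?m)\<^sup>2" by (simp add: power2_eq_square algebra_simps)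
  also have "\<dots> \<le> ?l\<^sup>2" by simp
  finally show ?thesis .
qed


section \<open>The forms for vectors of size k-1: inequality and equality\<close>

lemma quad_0:
  assumes "b \<in> J"
  defines "z \<equiv> \<lambda>x i. x i * local_weight b i"
  shows "quad q 0 b x = weight b * (q * (x 0)\<^sup>2 + 2 * x 0 * sum (z x) (Cont n J b) + pair_form b (z x))"
proof -
  let ?C = "Cont n J b"
  have 1: "(\<Sum>i\<in>{1..n}. x i * ext_sum 0 (b + unit_vec i)) = weight b * sum (z x) ?C"
  proof -
    have "(\<Sum>i\<in>{1..n}. x i * ext_sum 0 (b + unit_vec i)) = (\<Sum>i\<in>?C. x i * ext_sum 0 (b + unit_vec i))"
      by (rule sum.mono_neutral_right) (auto simp: Cont_def)
    also have "\<dots> = (\<Sum>i\<in>?C. weight b * z x i)"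
      by (intro sum.cong refl) (auto simp: z_def weight_add_unit Cont_def)
    finally show ?thesis by (simp only: sum_distrib_left)
  qed
  let ?A = "\<lambda>i j. x i * x j * ext_sum 0 (b + unit_vec i + unit_vec j)"
  have "(\<Sum>i\<in>{1..n}. \<Sum>j\<in>{1..n}. ?A i j) = (\<Sum>i\<in>?C. \<Sum>j\<in>?C. ?A i j)"
  proof -
    have out: "?A i j = 0" if "i \<notin> ?C \<or> j \<notin> ?C" for i j
    proof -
      have "b + unit_vec i + unit_vec j \<notin> J"
        using that add_unit_downward[of "b + unit_vec i" j] add_unit_downward2[of b i j] mem_Cont by blast
      then show ?thesis by simp
    qed
    have "(\<Sum>i\<in>{1..n}. \<Sum>j\<in>{1..n}. ?A i j) = (\<Sum>i\<in>?C. \<Sum>j\<in>{1..n}. ?A i j)"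
      using Cont_subset out by (intro sum.mono_neutral_right) (auto intro!: sum.neutral simp del: ext_sum.simps)
    also have "\<dots> = (\<Sum>i\<in>?C. \<Sum>j\<in>?C. ?A i j)"
      using Cont_subset out by (intro sum.cong refl sum.mono_neutral_right) (auto simp del: ext_sum.simps)
    finally show ?thesis .
  qed
  also have "\<dots> = (\<Sum>i\<in>?C. \<Sum>j\<in>?C. weight b * (z x i * z x j *
     (if b + unit_vec i + unit_vec j \<in> J then if i = j then t else 1 else 0)))"
    by (intro sum.cong refl) (simp add: z_def weight_add_unit2 Cont_def)
  finally have 2: "(\<Sum>i\<in>{1..n}. \<Sum>j\<in>{1..n}. ?A i j) = weight b * pair_form b (z x)"
    by (simp only: pair_form_def sum_distrib_left)
  show ?thesis unfolding quad_def 1 2 using assms by (simp add: algebra_simps)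
qed

lemma ext_sum_1:
  assumes "b \<in> J"
  shows "ext_sum 1 b = weight b * sum (local_weight b) (Cont n J b)"
proof -
  have "ext_sum 1 b = (\<Sum>i\<in>{1..n}. if i \<in> Cont n J b then weight b * local_weight b i else 0)"
    unfolding One_nat_def ext_sum.simps by (intro sum.cong refl) (auto simp: mem_Cont weight_add_unit)
  also have "\<dots> = (\<Sum>i\<in>{1..n} \<inter> Cont n J b. weight b * local_weight b i)"
    by (rule sum.inter_restrict[symmetric]) simp
  also have "{1..n} \<inter> Cont n J b = Cont n J b" using Cont_subset by blast
  finally show ?thesis by (simp only: sum_distrib_left)
qed

lemma ext_sum_2:
  assumes "b \<in> J"
  shows "ext_sum 2 b = weight b * pair_form b (local_weight b)"
proof -
  let ?x = "\<lambda>i::nat. if i = 0 then 0 else 1 :: real"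
  have "ext_sum 2 b = quad 0 0 b ?x"
  proof -
    have "quad 0 0 b ?x = (\<Sum>i\<in>{1..n}. \<Sum>j\<in>{1..n}. ?x i * ?x j * ext_sum 0 (b + unit_vec i + unit_vec j))"
      by (simp add: quad_def)
    also have "\<dots> = (\<Sum>i\<in>{1..n}. \<Sum>j\<in>{1..n}. ext_sum 0 (b + unit_vec i + unit_vec j))"
      by (intro sum.cong refl) auto
    finally show ?thesis by (simp add: numeral_2_eq_2)
  qed
  also have "\<dots> = weight b * pair_form b (\<lambda>i. ?x i * local_weight b i)"
    by (simp add: quad_0[OF assms])
  also have "pair_form b (\<lambda>i. ?x i * local_weight b i) = pair_form b (local_weight b)"
    unfolding pair_form_def by (intro sum.cong refl) (auto simp: Cont_def)
  finally show ?thesis .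
qed

lemma sum_local_weight_pos:
  assumes "b \<in> J" "vec_size n b < rk n J"
  shows "sum (local_weight b) (Cont n J b) > 0"
proof -
  obtain i where "i \<in> Cont n J b" using extend assms .
  then show ?thesis by (intro sum_pos finite_Cont local_weight_pos) (auto simp: Cont_def)
qed

lemma base_hyperbolic:
  assumes b: "b \<in> J" "vec_size n b < rk n J"
    and p: "real (card (Par n J b)) \<le> p" "p > 0"
    and q: "q * (1 - (1 - t) / p) = 1"
  shows "ext_sum 2 b * quad q 0 b x \<le> (lin 0 b x)\<^sup>2"
proof -
  let ?C = "Cont n J b" and ?y = "local_weight b"
  \<comment> \<open>Chosen so that the rescaled variables sum to - q x_0, the zero of the square (q
    x_0 + S)^2 / q that bounds the form.\<close>
  define s where "s = (q * x 0 + (\<Sum>i\<in>?C. x i * ?y i)) / sum ?y ?C"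
  define z where "z = (\<lambda>i. shift s x i * ?y i)"
  have "sum z ?C = (\<Sum>i\<in>?C. x i * ?y i - s * ?y i)"
    unfolding z_def shift_def by (intro sum.cong refl) (auto simp: Cont_def algebra_simps)
  also have "\<dots> = (\<Sum>i\<in>?C. x i * ?y i) - s * sum ?y ?C"
    by (simp only: sum_subtractf sum_distrib_left)
  also have "\<dots> = - q * x 0" using sum_local_weight_pos[OF b] by (simp add: s_def)
  finally have S: "sum z ?C = - q * x 0" .
  have "pair_form b z \<le> (1 - (1 - t) / p) * (sum z ?C)\<^sup>2"
  proof -
    have "0 \<le> (1 - t) * (\<Sum>P\<in>Par n J b. (sum z P - sum z ?C / p)\<^sup>2)"
      "0 \<le> t * (\<Sum>P\<in>Par n J b - (\<lambda>i. {i}) ` {i. b + unit_vec i + unit_vec i \<in> J}. (sum z P)\<^sup>2)"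
      using t_pos t_less_1 by (simp_all add: sum_nonneg)
    then show ?thesis using pair_form_bound[OF p, of z] by linarith
  qed
  also have "\<dots> = (q * (1 - (1 - t) / p)) * (q * (x 0)\<^sup>2)"
    unfolding S by (simp only: power2_eq_square) (simp add: algebra_simps)
  finally have "pair_form b z \<le> q * (x 0)\<^sup>2" using q by simp
  then have "q * (x 0)\<^sup>2 + 2 * x 0 * sum z ?C + pair_form b z \<le> 0"
    unfolding S by (simp add: power2_eq_square algebra_simps)
  moreover have "quad q 0 b (shift s x) = weight b * (q * (x 0)\<^sup>2 + 2 * x 0 * sum z ?C + pair_form b z)"
    unfolding quad_0[OF b(1)] by (simp add: z_def shift_def)
  ultimately have "quad q 0 b (shift s x) \<le> 0"
    using weight_gt_0[of b] by (simp add: mult_le_0_iff)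
  then show ?thesis using reverse_Cauchy_Schwarz[of q 0 b s x] by (simp only: add_0)
qed

text \<open>A null vector (1,-c,...,-c) turns Cauchy-Schwarz for \<open>local_weight\<close> into an
  equality. All classes then have the same sum, and those outside \<open>T\<close> have sum zero,
  which positive weights forbid; so every class is some {i} with b + 2 e_i in J. The common value q
  / (c * p) does not depend on b, which is what makes different b comparable.\<close>

lemma base_equality:
  assumes b: "b \<in> J" "vec_size n b < rk n J"
    and p: "real (card (Par n J b)) \<le> p" "p > 0"
    and q: "q * (1 - (1 - t) / p) = 1"
    and c: "c > 0"
    and x: "x = shift c (\<lambda>i. if i = 0 then 1 else 0)"
    and zero: "quad q 0 b x = 0" "lin 0 b x = 0"
    and i: "i \<in> Cont n J b"
  shows "local_weight b i = q / (c * p) \<and> (\<forall>j\<in>Cont n J b. b + unit_vec i + unit_vec j \<in> J)"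
proof -
  let ?C = "Cont n J b" and ?y = "local_weight b" and ?e = "\<lambda>i::nat. if i = 0 then 1 else 0 :: real"
  let ?S = "sum ?y ?C" and ?Q = "pair_form b ?y"
  define X where "X = ?Q"
  have "quad q 0 b ?e = q * weight b"
    using b(1) by (simp add: quad_def)
  moreover have "lin 0 b ?e = weight b * ?S"
    using ext_sum_1[OF b(1)] by (simp add: lin_def)
  ultimately have "weight b * (q - 2 * c * ?S + c\<^sup>2 * X) = 0" "weight b * (?S - c * X) = 0"
    using zero quad_shift[of q 0 b c ?e, unfolded add_0] lin_shift[of 0 b c ?e, unfolded add_0] ext_sum_2[OF b(1)]
    by (simp_all add: x X_def algebra_simps)
  then have *: "q - 2 * c * ?S + c\<^sup>2 * X = 0" "?S = c * X" using weight_gt_0[of b] by auto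
  then have qS: "q = c * ?S" by (simp add: power2_eq_square algebra_simps)
  \<comment> \<open>The upper bound of \<open>pair_form_bound\<close> is attained, so its two
    surplus terms are squeezed to zero.\<close>
  have "(1 - (1 - t) / p) * ?S\<^sup>2 = X"
  proof -
    have "c * ((1 - (1 - t) / p) * ?S\<^sup>2) = q * (1 - (1 - t) / p) * ?S" by (simp add: qS power2_eq_square algebra_simps)
    also have "\<dots> = c * X" using q *(2) by simp
    finally show ?thesis using c by simp
  qed
  then have le: "(1 - t) * (\<Sum>P\<in>Par n J b. (sum ?y P - ?S / p)\<^sup>2)
      + t * (\<Sum>P\<in>Par n J b - (\<lambda>i. {i}) ` {i. b + unit_vec i + unit_vec i \<in> J}. (sum ?y P)\<^sup>2) \<le> 0"
    using pair_form_bound[OF p, of ?y] by (simp add: X_def)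
  have ge: "0 \<le> (\<Sum>P\<in>Par n J b. (sum ?y P - ?S / p)\<^sup>2)"
    "0 \<le> (\<Sum>P\<in>Par n J b - (\<lambda>i. {i}) ` {i. b + unit_vec i + unit_vec i \<in> J}. (sum ?y P)\<^sup>2)"
    by (simp_all add: sum_nonneg)
  then have "(1 - t) * (\<Sum>P\<in>Par n J b. (sum ?y P - ?S / p)\<^sup>2) = 0"
    "t * (\<Sum>P\<in>Par n J b - (\<lambda>i. {i}) ` {i. b + unit_vec i + unit_vec i \<in> J}. (sum ?y P)\<^sup>2) = 0"
    using le t_pos t_less_1 mult_nonneg_nonneg[OF _ ge(1), of "1 - t"] mult_nonneg_nonneg[OF _ ge(2), of t]
    by linarith+
  then have "(\<Sum>P\<in>Par n J b. (sum ?y P - ?S / p)\<^sup>2) = 0"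
    "(\<Sum>P\<in>Par n J b - (\<lambda>i. {i}) ` {i. b + unit_vec i + unit_vec i \<in> J}. (sum ?y P)\<^sup>2) = 0"
    using t_pos t_less_1 by simp_all
  then have class_sum: "sum ?y P = ?S / p"
    "P \<notin> (\<lambda>i. {i}) ` {i. b + unit_vec i + unit_vec i \<in> J} \<Longrightarrow> sum ?y P = 0" if "P \<in> Par n J b" for P
    using that finite_Par by (auto simp: sum_nonneg_eq_0_iff)
  let ?P = "par_rel n J b `` {i}"
  have P: "?P \<in> Par n J b" using i by (auto simp: Par_def intro: quotientI)
  have iP: "i \<in> ?P" using i by (simp add: par_rel_def)
  have "sum ?y ?P > 0"
    using iP finite_Cont by (intro sum_pos local_weight_pos) (auto simp: par_rel_def Cont_def)
  then have "?P \<in> (\<lambda>i. {i}) ` {i. b + unit_vec i + unit_vec i \<in> J}" using class_sum(2)[OF P] by force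
  then obtain l where l: "?P = {l}" "b + unit_vec l + unit_vec l \<in> J" by blast
  moreover from this have "l = i" using iP unfolding l(1) by simp
  ultimately have Pi: "?P = {i}" "b + unit_vec i + unit_vec i \<in> J" by blast+
  have "?y i = ?S / p" using class_sum(1)[OF P] unfolding Pi(1) by simp
  also have "\<dots> = q / (c * p)" using c by (simp add: qS)
  finally have "?y i = q / (c * p)" .
  moreover have "b + unit_vec i + unit_vec j \<in> J" if "j \<in> ?C" for j
  proof (cases "j = i")
    case False
    then have "(i, j) \<notin> par_rel n J b" using Pi(1) by auto
    then show ?thesis using i that by (auto simp: par_rel_def)
  qed (use Pi in simp)
  ultimately show ?thesis by blast
qed


section \<open>Passing from the derivatives of b up to b\<close>

lemma quad_eq_zero: "b \<notin> J \<Longrightarrow> quad q r b x = 0"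
proof -
  assume b: "b \<notin> J"
  then have "b + unit_vec j \<notin> J" "b + unit_vec j + unit_vec l \<notin> J" for j l
    using add_unit_downward by blast+
  then show ?thesis using b by (simp add: quad_def ext_sum_eq_zero)
qed

lemma quad_Suc_le:
  assumes b: "b \<in> J" "vec_size n b + r + 3 \<le> rk n J"
    and hyp: "\<And>i x. i \<in> Cont n J b \<Longrightarrow>
      ext_sum (r + 2) (b + unit_vec i) * quad q r (b + unit_vec i) x \<le> (lin r (b + unit_vec i) x)\<^sup>2"
  shows "quad q (Suc r) b x \<le> (\<Sum>i\<in>Cont n J b. (lin r (b + unit_vec i) x)\<^sup>2 / ext_sum (r + 2) (b + unit_vec i))"
proof -
  have pos: "ext_sum (r + 2) (b + unit_vec i) > 0" if "i \<in> Cont n J b" for i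
    using that b vec_size_add_unit[of i n b] by (intro ext_sum_pos) (auto simp: Cont_def)
  have zero: "quad q r (b + unit_vec i) x = 0" if "i \<notin> Cont n J b" for i
    using that mem_Cont by (intro quad_eq_zero) blast
  have "quad q (Suc r) b x = (\<Sum>i\<in>Cont n J b. quad q r (b + unit_vec i) x)"
    unfolding quad_Suc using zero Cont_subset by (intro sum.mono_neutral_right) auto
  also have "\<dots> \<le> (\<Sum>i\<in>Cont n J b. (lin r (b + unit_vec i) x)\<^sup>2 / ext_sum (r + 2) (b + unit_vec i))"
    using hyp pos by (intro sum_mono) (simp add: pos_le_divide_eq mult.commute)
  finally show ?thesis .
qed

text \<open>Indices that cannot be added together still have a common neighbour: extend b + e_i by
  some l, and exchange forces l to be joinable with j. The rank bound is what provides l.\<close>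

lemma connected_Cont:
  assumes b: "b \<in> J" "vec_size n b + m + 2 \<le> rk n J"
    and y: "\<And>i j. i \<in> Cont n J b \<Longrightarrow> j \<in> Cont n J b \<Longrightarrow>
        ext_sum m (b + unit_vec i + unit_vec j) > 0 \<Longrightarrow> y i = y j"
    and ij: "i \<in> Cont n J b" "j \<in> Cont n J b"
  shows "y i = y j"
proof -
  have pos: "ext_sum m (b + unit_vec i + unit_vec j) > 0" if "b + unit_vec i + unit_vec j \<in> J" for i j
  proof (rule ext_sum_pos[OF that])
    have "i \<in> {1..n}" "j \<in> {1..n}" using that add_unit_index add_unit_downward by blast+
    then show "vec_size n (b + unit_vec i + unit_vec j) + m \<le> rk n J" using b(2) by (simp add: vec_size_add_unit)
  qed
  have eq: "y i = y j" if "b + unit_vec i + unit_vec j \<in> J" for i j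
    using y[OF _ _ pos[OF that]] that add_unit_downward add_unit_downward2 mem_Cont by blast
  show ?thesis
  proof (cases "b + unit_vec i + unit_vec j \<in> J")
    case False
    have bi: "b + unit_vec i \<in> J" "b + unit_vec j \<in> J" "i \<in> {1..n}" using ij mem_Cont by (auto simp: Cont_def)
    then obtain l where "l \<in> Cont n J (b + unit_vec i)"
      using extend[of "b + unit_vec i"] b(2) vec_size_add_unit[OF bi(3), of b] by auto
    then have il: "b + unit_vec i + unit_vec l \<in> J" using mem_Cont by blast
    have "b + unit_vec j + unit_vec i \<notin> J" using False by (simp add: add_ac)
    then have "b + unit_vec j + unit_vec l \<in> J" using exchange_pair[OF bi(2) il] by blast
    then show ?thesis using eq il by metis
  qed (rule eq)
qed

text \<open>\<open>trickling_down\<close> controls only the block \<open>A\<close> on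
  \<open>Cont\<close>, whose row sums \<open>h\<close> are the values of the local forms at
  (0,1,...,1); the full form also contains x_0. Writing D for the sum on the right, the two facts to
  combine are quad <= G at x and quad + 2 D + G <= 0; they give quad <= - D.\<close>

lemma quad_Suc_orthogonal:
  assumes b: "b \<in> J" "vec_size n b + r + 3 \<le> rk n J"
    and hyp: "\<And>i x. i \<in> Cont n J b \<Longrightarrow>
      ext_sum (r + 2) (b + unit_vec i) * quad q r (b + unit_vec i) x \<le> (lin r (b + unit_vec i) x)\<^sup>2"
    and orth: "lin (Suc r) b x = 0"
  shows "quad q (Suc r) b x \<le> - (\<Sum>i\<in>Cont n J b. (lin r (b + unit_vec i) x)\<^sup>2 / ext_sum (r + 2) (b + unit_vec i))"
proof -
  define C where "C = Cont n J b"
  define A where "A = (\<lambda>i j. ext_sum (Suc r) (b + unit_vec i + unit_vec j))"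
  define h where "h = (\<lambda>i. ext_sum (r + 2) (b + unit_vec i))"
  define a where "a = (\<lambda>x i. lin r (b + unit_vec i) x)"
  have fin: "finite C" and sub: "C \<subseteq> {1..n}" using finite_Cont Cont_subset by (auto simp: C_def)
  have sym: "A i j = A j i" for i j by (simp add: A_def add_ac)
  have A_nonneg: "A i j \<ge> 0" for i j by (simp only: A_def ext_sum_nonneg)
  have A_zero: "A i j = 0" if "i \<notin> C \<or> j \<notin> C" for i j
  proof -
    have "b + unit_vec i + unit_vec j \<notin> J"
      using that add_unit_downward[of "b + unit_vec i" j] add_unit_downward2[of b i j] mem_Cont
      unfolding C_def by blast
    then show ?thesis unfolding A_def by (rule ext_sum_eq_zero)
  qed
  have row: "(\<Sum>j\<in>{1..n}. f j * A i j) = (\<Sum>j\<in>C. f j * A i j)" for f i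
    using sub A_zero by (intro sum.mono_neutral_right) auto
  have h: "h i = (\<Sum>j\<in>C. A i j)" for i
    using row[of "\<lambda>_. 1" i] by (simp add: h_def A_def)
  have hpos: "h i > 0" if "i \<in> C" for i
    unfolding h_def using that b vec_size_add_unit[of i n b] by (intro ext_sum_pos) (auto simp: C_def Cont_def)
  have le: "quad q (Suc r) b x \<le> (\<Sum>i\<in>C. (a x i)\<^sup>2 / h i)" for x
    using quad_Suc_le[OF b hyp] by (simp only: C_def a_def h_def)
  have add: "quad q (Suc r) b (\<lambda>i. x i + z i)
      = quad q (Suc r) b x + 2 * (\<Sum>i\<in>C. z i * a x i) + (\<Sum>i\<in>C. \<Sum>j\<in>C. z i * z j * A i j)"
    if z: "\<And>i. i \<notin> C \<Longrightarrow> z i = 0" for x z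
  proof -
    have "0 \<notin> C" using sub by auto
    then have z0: "z 0 = 0" by (rule z)
    have "(\<Sum>i\<in>{1..n}. z i * a x i) = (\<Sum>i\<in>C. z i * a x i)"
      using sub z by (intro sum.mono_neutral_right) auto
    moreover have "(\<Sum>i\<in>{1..n}. \<Sum>j\<in>{1..n}. z i * z j * A i j) = (\<Sum>i\<in>C. \<Sum>j\<in>{1..n}. z i * z j * A i j)"
      using sub z by (intro sum.mono_neutral_right) auto
    moreover have "(\<Sum>i\<in>C. \<Sum>j\<in>{1..n}. z i * z j * A i j) = (\<Sum>i\<in>C. \<Sum>j\<in>C. z i * z j * A i j)"
      using sub z by (intro sum.cong refl sum.mono_neutral_right) auto
    ultimately show ?thesis using quad_Suc_add[of z q r b x, OF z0] by (simp only: a_def A_def)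
  qed
  have a_add: "a (\<lambda>i. x i + z i) i = a x i + (\<Sum>j\<in>C. z j * A i j)" if "z 0 = 0" for x z i
    unfolding a_def A_def[symmetric] row[symmetric] using lin_add[of z, OF that, of r "b + unit_vec i" x] by (simp only: A_def)
  have nonpos: "(\<Sum>i\<in>C. \<Sum>j\<in>C. z i * z j * A i j) \<le> 0" if "(\<Sum>i\<in>C. h i * z i) = 0" for z
  proof (rule trickling_down[OF fin sym A_nonneg h hpos _ _ that])
    show "\<forall>i\<in>C. \<forall>j\<in>C. y i = y j"
      if "\<And>i j. i \<in> C \<Longrightarrow> j \<in> C \<Longrightarrow> A i j > 0 \<Longrightarrow> y i = y j" for y :: "nat \<Rightarrow> real"
    proof (intro ballI)
      fix i j assume "i \<in> C" "j \<in> C"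
      then show "y i = y j"
        using connected_Cont[OF b(1), of "Suc r" y i j] b(2) that unfolding C_def A_def by simp
    qed
    show "(\<Sum>i\<in>C. \<Sum>j\<in>C. y i * y j * A i j) \<le> (\<Sum>i\<in>C. (\<Sum>j\<in>C. y j * A i j)\<^sup>2 / h i)" for y
    proof -
      \<comment> \<open>Vectors with zero coordinate at x_0: there the local inequality reduces to
        the hypothesis P <= P^2 of the spectral step.\<close>
      define z where "z = (\<lambda>i. if i \<in> C then y i else 0)"
      have z0: "z 0 = 0" using sub by (auto simp: z_def)
      have q0: "quad q (Suc r) b (\<lambda>i. 0) = 0" and a0: "a (\<lambda>i. 0) i = 0" for i by (simp_all add: quad_def a_def lin_def)
      have "(\<Sum>i\<in>C. \<Sum>j\<in>C. z i * z j * A i j) \<le> (\<Sum>i\<in>C. (\<Sum>j\<in>C. z j * A i j)\<^sup>2 / h i)"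
        using le[of "\<lambda>i. 0 + z i"] add[of z "\<lambda>i. 0"] a_add[of z, OF z0, of "\<lambda>i. 0"] by (simp add: q0 a0) (simp add: z_def)
      then show ?thesis by (simp add: z_def cong: sum.cong)
    qed
  qed
  \<comment> \<open>Moving \<open>x\<close> along the gradient \<open>g x\<close> and comparing both sides of the local inequality
    gives \<open>quad \<le> G\<close>, since the operator \<open>A / h\<close> is a contraction; applied again to the moved
    point, it gives the sharper bound.\<close>
  define D where "D = (\<lambda>x. \<Sum>i\<in>C. (a x i)\<^sup>2 / h i)"
  define g where "g = (\<lambda>x i. if i \<in> C then a x i / h i else 0)"
  define G where "G = (\<lambda>x. \<Sum>i\<in>C. \<Sum>j\<in>C. g x i * g x j * A i j)"
  have g_zero: "g x i = 0" if "i \<notin> C" for x i using that by (simp add: g_def)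
  have g0: "g x 0 = 0" for x using sub by (intro g_zero) auto
  have hg: "h i * g x i = a x i" if "i \<in> C" for x i using hpos[OF that] that by (simp add: g_def)
  \<comment> \<open>By Euler's identity the sum of the h_i g_i is \<open>lin (Suc r) b x\<close>;
    gradient moves thus stay in the kernel of \<open>lin\<close> and the spectral bound applies to
    them.\<close>
  have g_orth: "(\<Sum>i\<in>C. h i * g x i) = 0" if "lin (Suc r) b x = 0" for x
  proof -
    have "a x i = 0" if "i \<notin> C" for i
    proof -
      have "b + unit_vec i \<notin> J" using that mem_Cont unfolding C_def by blast
      moreover from this have "b + unit_vec i + unit_vec j \<notin> J" for j using add_unit_downward by blast
      ultimately show ?thesis by (simp add: a_def lin_def ext_sum_eq_zero del: ext_sum.simps)
    qed
    then have "(\<Sum>i\<in>{1..n}. a x i) = (\<Sum>i\<in>C. a x i)"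
      using sub by (intro sum.mono_neutral_right) auto
    then show ?thesis using that by (simp add: hg lin_Suc a_def)
  qed
  have ga: "(\<Sum>i\<in>C. g x i * a x i) = D x" for x
    by (simp add: D_def g_def power2_eq_square)
  have hgg: "(\<Sum>i\<in>C. h i * (g x i)\<^sup>2) = D x" for x
    unfolding ga[symmetric] by (intro sum.cong refl) (simp add: hg[symmetric] power2_eq_square)
  have contraction: "(\<Sum>i\<in>C. (\<Sum>j\<in>C. g x j * A i j)\<^sup>2 / h i) \<le> D x" for x
  proof -
    have "(\<Sum>j\<in>C. g x j * A i j)\<^sup>2 / h i \<le> (\<Sum>j\<in>C. A i j * (g x j)\<^sup>2)" if "i \<in> C" for i
    proof -
      let ?s = "\<Sum>j\<in>C. g x j * A i j"
      \<comment> \<open>The variance of g with respect to row i, whose weighted mean is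
        \<open>?s / h i\<close>.\<close>
      have "0 \<le> (\<Sum>j\<in>C. A i j * (g x j - ?s / h i)\<^sup>2)" by (intro sum_nonneg mult_nonneg_nonneg A_nonneg) simp
      also have "\<dots> = (\<Sum>j\<in>C. A i j * (g x j)\<^sup>2 - 2 * (?s / h i) * (g x j * A i j) + (?s / h i)\<^sup>2 * A i j)"
        by (intro sum.cong refl) (simp add: power2_eq_square algebra_simps)
      also have "\<dots> = (\<Sum>j\<in>C. A i j * (g x j)\<^sup>2) - 2 * (?s / h i) * ?s + (?s / h i)\<^sup>2 * h i"
        by (simp only: sum.distrib sum_subtractf sum_distrib_left[symmetric] h[symmetric])
      finally show ?thesis using hpos[OF that] by (simp add: power2_eq_square)
    qed
    then have "(\<Sum>i\<in>C. (\<Sum>j\<in>C. g x j * A i j)\<^sup>2 / h i) \<le> (\<Sum>i\<in>C. \<Sum>j\<in>C. A i j * (g x j)\<^sup>2)"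
      by (rule sum_mono)
    also have "\<dots> = (\<Sum>j\<in>C. \<Sum>i\<in>C. A j i * (g x j)\<^sup>2)"
      by (subst sum.swap) (simp only: sym)
    also have "\<dots> = D x"
      unfolding hgg[symmetric] h sum_distrib_right ..
    finally show ?thesis .
  qed
  have add_g: "quad q (Suc r) b (\<lambda>i. x i + g x i) = quad q (Suc r) b x + 2 * D x + G x" for x
    unfolding G_def ga[symmetric] by (rule add) (rule g_zero)
  have le_G: "quad q (Suc r) b x \<le> G x" for x
  proof -
    have "quad q (Suc r) b x + 2 * D x + G x \<le> (\<Sum>i\<in>C. (a x i + (\<Sum>j\<in>C. g x j * A i j))\<^sup>2 / h i)"
      using le[of "\<lambda>i. x i + g x i"] add_g[of x] unfolding a_add[of "g x", OF g0] by linarith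
    also have "\<dots> = (\<Sum>i\<in>C. (a x i)\<^sup>2 / h i + 2 * (\<Sum>j\<in>C. g x i * g x j * A i j) + (\<Sum>j\<in>C. g x j * A i j)\<^sup>2 / h i)"
    proof (intro sum.cong refl)
      fix i assume "i \<in> C"
      then have gi: "g x i = a x i / h i" by (simp add: g_def)
      define s where "s = (\<Sum>j\<in>C. g x j * A i j)"
      have "(\<Sum>j\<in>C. g x i * g x j * A i j) = a x i / h i * s"
        unfolding gi s_def sum_distrib_left mult.assoc ..
      then show "(a x i + (\<Sum>j\<in>C. g x j * A i j))\<^sup>2 / h i =
          (a x i)\<^sup>2 / h i + 2 * (\<Sum>j\<in>C. g x i * g x j * A i j) + (\<Sum>j\<in>C. g x j * A i j)\<^sup>2 / h i"
        unfolding s_def[symmetric] by (simp add: power2_sum add_divide_distrib)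
    qed
    also have "\<dots> = D x + 2 * G x + (\<Sum>i\<in>C. (\<Sum>j\<in>C. g x j * A i j)\<^sup>2 / h i)"
      by (simp only: sum.distrib D_def G_def sum_distrib_left[symmetric])
    finally show ?thesis using contraction[of x] by linarith
  qed
  define x' where "x' = (\<lambda>i. x i + g x i)"
  have "lin (Suc r) b x' = (\<Sum>i\<in>{1..n}. g x i * h i)"
    unfolding x'_def by (subst lin_add) (simp_all only: orth g0 h_def add_2_eq_Suc' add_0)
  also have "\<dots> = (\<Sum>i\<in>C. h i * g x i)"
    using sub g_zero by (simp only: mult.commute[of "h _"]) (intro sum.mono_neutral_right, auto)
  finally have "lin (Suc r) b x' = 0" using g_orth[OF orth] by simp
  then have "quad q (Suc r) b x' \<le> 0"
    using le_G[of x'] nonpos[OF g_orth, of x'] by (simp add: G_def)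
  moreover have "quad q (Suc r) b x' = quad q (Suc r) b x + 2 * D x + G x"
    unfolding x'_def by (rule add_g)
  ultimately have "quad q (Suc r) b x \<le> - D x" using le_G[of x] by linarith
  then show ?thesis by (simp only: D_def a_def h_def C_def)
qed


text \<open>Downward induction on the size of b, with r = K - |b| derivatives left. At b = 0 and x
  the axis of x_0 it is the log-concavity inequality itself. The bound on K keeps
  \<open>ext_sum (r + 2) b\<close> positive, so that the projecting shift exists.\<close>

lemma hyperbolic:
  assumes K: "K + 2 \<le> rk n J"
    and p: "p = real (max_par n J K)"
    and q: "q * (1 - (1 - t) / p) = 1"
  shows "b \<in> J \<Longrightarrow> vec_size n b + r = K \<Longrightarrow> ext_sum (r + 2) b * quad q r b x \<le> (lin r b x)\<^sup>2"
proof (induction r arbitrary: b x)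
  case 0
  then have b: "b \<in> J" "vec_size n b < rk n J" "vec_size n b = K" using K by auto
  then have "real (card (Par n J b)) \<le> p" "p > 0"
    using card_Par_le[of b] card_Par_pos[of b] p by auto
  then have "ext_sum 2 b * quad q 0 b x \<le> (lin 0 b x)\<^sup>2" by (intro base_hyperbolic[OF b(1,2) _ _ q])
  then show ?case by (simp only: add_0)
next
  case (Suc r)
  have hyp: "ext_sum (r + 2) (b + unit_vec i) * quad q r (b + unit_vec i) x \<le> (lin r (b + unit_vec i) x)\<^sup>2"
    if "i \<in> Cont n J b" for i x
    using that Suc.prems vec_size_add_unit[of i n b] by (intro Suc.IH) (auto simp: Cont_def)
  define s where "s = lin (Suc r) b x / ext_sum (Suc r + 2) b"
  have pos: "ext_sum (Suc r + 2) b > 0" using Suc.prems K by (intro ext_sum_pos) auto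
  have orth: "lin (Suc r) b (shift s x) = 0" using pos by (simp add: lin_shift s_def del: ext_sum.simps add_2_eq_Suc' add_Suc)
  have "vec_size n b + r + 3 \<le> rk n J" using Suc.prems K by simp
  from quad_Suc_orthogonal[OF Suc.prems(1) this hyp orth]
  have "quad q (Suc r) b (shift s x)
      \<le> - (\<Sum>i\<in>Cont n J b. (lin r (b + unit_vec i) (shift s x))\<^sup>2 / ext_sum (r + 2) (b + unit_vec i))" .
  also have "\<dots> \<le> 0" unfolding neg_le_0_iff_le by (intro sum_nonneg divide_nonneg_nonneg ext_sum_nonneg) simp
  finally show ?case by (rule reverse_Cauchy_Schwarz)
qed

section \<open>The case of equality\<close>

lemma obtain_minus_unit:
  fixes b :: "nat \<Rightarrow> nat"
  assumes "b i > 0"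
  obtains d where "b = d + unit_vec i"
proof
  show "b = b(i := b i - 1) + unit_vec i" using assms by (auto simp: unit_vec_def plus_fun_apply)
qed

text \<open>The surplus in \<open>quad_Suc_orthogonal\<close> forces every \<open>lin\<close> at b +
  e_i to vanish. The local inequalities then make every \<open>quad\<close> at b + e_i nonpositive,
  while these sum to zero.\<close>

lemma null_vector_step:
  assumes K: "K + 2 \<le> rk n J"
    and p: "p = real (max_par n J K)"
    and q: "q * (1 - (1 - t) / p) = 1"
    and b: "b \<in> J" "vec_size n b + Suc r = K"
    and null: "quad q (Suc r) b x = 0" "lin (Suc r) b x = 0"
    and i: "i \<in> Cont n J b"
  shows "quad q r (b + unit_vec i) x = 0 \<and> lin r (b + unit_vec i) x = 0"
proof -
  have hyp: "ext_sum (r + 2) (b + unit_vec i) * quad q r (b + unit_vec i) x \<le> (lin r (b + unit_vec i) x)\<^sup>2"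
    if "i \<in> Cont n J b" for i x
    using that b vec_size_add_unit[of i n b] by (intro hyperbolic[OF K p q]) (auto simp: Cont_def)
  have pos: "ext_sum (r + 2) (b + unit_vec i) > 0" if "i \<in> Cont n J b" for i
    using that b K vec_size_add_unit[of i n b] by (intro ext_sum_pos) (auto simp: Cont_def)
  have "vec_size n b + r + 3 \<le> rk n J" using b K by simp
  from quad_Suc_orthogonal[OF b(1) this hyp null(2)]
  have "(\<Sum>i\<in>Cont n J b. (lin r (b + unit_vec i) x)\<^sup>2 / ext_sum (r + 2) (b + unit_vec i)) \<le> 0"
    using null(1) by simp
  moreover have nonneg: "(lin r (b + unit_vec i) x)\<^sup>2 / ext_sum (r + 2) (b + unit_vec i) \<ge> 0" for i
    by (intro divide_nonneg_nonneg ext_sum_nonneg) simp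
  ultimately have "(\<Sum>i\<in>Cont n J b. (lin r (b + unit_vec i) x)\<^sup>2 / ext_sum (r + 2) (b + unit_vec i)) = 0"
    by (intro antisym sum_nonneg)
  then have all: "\<forall>i\<in>Cont n J b. (lin r (b + unit_vec i) x)\<^sup>2 / ext_sum (r + 2) (b + unit_vec i) = 0"
    using nonneg by (subst (asm) sum_nonneg_eq_0_iff) (auto simp only: finite_Cont)
  have lin: "lin r (b + unit_vec i) x = 0" if "i \<in> Cont n J b" for i
  proof -
    have "(lin r (b + unit_vec i) x)\<^sup>2 / ext_sum (r + 2) (b + unit_vec i) = 0" using all that by blast
    then show ?thesis using pos[OF that] by (simp del: ext_sum.simps add_2_eq_Suc')
  qed
  have le: "0 \<le> - quad q r (b + unit_vec i) x" for i
  proof (cases "i \<in> Cont n J b")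
    case True
    then show ?thesis using hyp[OF True, of x] lin[OF True] pos[OF True]
      by (simp add: mult_le_0_iff del: ext_sum.simps add_2_eq_Suc')
  next
    case False
    then have "b + unit_vec i \<notin> J" using mem_Cont by blast
    then show ?thesis by (simp add: quad_eq_zero)
  qed
  have "(\<Sum>i\<in>{1..n}. - quad q r (b + unit_vec i) x) = 0"
    using null(1) by (simp add: quad_Suc sum_negf)
  then have "\<forall>i\<in>{1..n}. - quad q r (b + unit_vec i) x = 0"
    using le by (subst (asm) sum_nonneg_eq_0_iff) auto
  then show ?thesis using i lin Cont_subset by auto
qed

lemma null_vector_descent:
  assumes K: "K + 2 \<le> rk n J"
    and p: "p = real (max_par n J K)"
    and q: "q * (1 - (1 - t) / p) = 1"
    and null: "quad q K 0 x = 0" "lin K 0 x = 0"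
  shows "b \<in> J \<Longrightarrow> vec_size n b + r = K \<Longrightarrow> quad q r b x = 0 \<and> lin r b x = 0"
proof (induction "vec_size n b" arbitrary: b r)
  case 0
  then have "b = 0" using vec_size_eq_zero by metis
  then show ?case using 0 null by simp
next
  case (Suc m)
  then obtain i where i: "i \<in> {1..n}" "b i > 0"
    by (metis (mono_tags, lifting) Zero_not_Suc neq0_conv sum.neutral vec_size_def)
  obtain d where d: "b = d + unit_vec i" using i(2) by (rule obtain_minus_unit)
  have dJ: "d \<in> J" using Suc.prems(1) unfolding d by (rule add_unit_downward)
  have size: "vec_size n b = Suc (vec_size n d)" unfolding d by (rule vec_size_add_unit[OF i(1)])
  then have d_size: "vec_size n d + Suc r = K" "m = vec_size n d" using Suc by simp_all
  have "quad q (Suc r) d x = 0 \<and> lin (Suc r) d x = 0" by (rule Suc.hyps(1)[OF d_size(2) dJ d_size(1)])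
  moreover have "i \<in> Cont n J d" using Suc.prems(1) d mem_Cont by blast
  ultimately show ?case
    using null_vector_step[OF K p q dJ d_size(1)] unfolding d by blast
qed

text \<open>The order of quantifiers matters: one l serves all b of size K and all i in
  \<open>Cont n J b\<close>.\<close>

lemma equality_local:
  assumes K: "K + 2 \<le> rk n J"
    and p: "p = real (max_par n J K)"
    and q: "q * (1 - (1 - t) / p) = 1"
    and eq: "(ext_sum (K + 1) 0)\<^sup>2 = q * ext_sum K 0 * ext_sum (K + 2) 0"
  shows "\<exists>l. \<forall>b\<in>J. vec_size n b = K \<longrightarrow> (\<forall>i\<in>Cont n J b. local_weight b i = l \<and>
            (\<forall>j\<in>Cont n J b. b + unit_vec i + unit_vec j \<in> J))"
proof -
  \<comment> \<open>This value puts the vector (1,-c,...,-c) into the kernel of \<open>lin\<close>;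
    the assumed equality then makes it null for \<open>quad\<close> as well.\<close>
  define c where "c = ext_sum (K + 1) 0 / ext_sum (K + 2) 0"
  define e :: "nat \<Rightarrow> real" where "e = (\<lambda>i. if i = 0 then 1 else 0)"
  define x where "x = shift c e"
  have size0: "vec_size n 0 = 0" by (simp add: vec_size_def zero_fun_apply)
  have pos: "ext_sum (K + 1) 0 > 0" "ext_sum (K + 2) 0 > 0"
    using K size0 by (intro ext_sum_pos zero_in_J; simp)+
  then have c: "c > 0" by (simp only: c_def divide_pos_pos)
  have e: "quad q K 0 e = q * ext_sum K 0" "lin K 0 e = ext_sum (K + 1) 0"
  proof -
    have "(\<Sum>i\<in>{1..n}. \<Sum>j\<in>{1..n}. e i * e j * ext_sum K (0 + unit_vec i + unit_vec j)) = 0"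
      "(\<Sum>i\<in>{1..n}. e i * ext_sum m (0 + unit_vec i)) = 0" for m
      by (intro sum.neutral ballI; simp add: e_def)+
    then show "quad q K 0 e = q * ext_sum K 0" "lin K 0 e = ext_sum (K + 1) 0"
      unfolding quad_def lin_def by (simp_all only: Suc_eq_plus1) (simp_all add: e_def del: ext_sum.simps)
  qed
  have c_mult: "c * ext_sum (K + 2) 0 = ext_sum (K + 1) 0" 
    unfolding c_def using pos(2) by (simp del: ext_sum.simps add_2_eq_Suc' add: less_imp_neq[symmetric])
  have lin: "lin K 0 x = 0" unfolding x_def lin_shift e c_mult by simp
  have quad: "quad q K 0 x = 0"
  proof -
    have "c * ext_sum (K + 1) 0 = q * ext_sum K 0"
    proof -
      have "c * ext_sum (K + 1) 0 * ext_sum (K + 2) 0 = (ext_sum (K + 1) 0)\<^sup>2"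
        using c_mult by (metis mult.assoc mult.commute power2_eq_square)
      then show ?thesis using eq pos(2) by (metis less_irrefl mult_right_cancel)
    qed
    then show ?thesis unfolding x_def quad_shift e power2_eq_square mult.assoc c_mult by simp
  qed
  have "local_weight b i = q / (c * p) \<and> (\<forall>j\<in>Cont n J b. b + unit_vec i + unit_vec j \<in> J)"
    if b: "b \<in> J" "vec_size n b = K" and i: "i \<in> Cont n J b" for b i
  proof -
    have "quad q 0 b x = 0 \<and> lin 0 b x = 0"
      using b by (intro null_vector_descent[OF K p q quad lin]) auto
    moreover have size: "vec_size n b < rk n J" using b K by simp
    moreover have "real (card (Par n J b)) \<le> p" "p > 0"
      using card_Par_le[OF b(1)] card_Par_pos[OF b(1) size] p b(2) by auto
    ultimately show ?thesis
      using base_equality[OF b(1) size _ _ q c x_def[unfolded e_def] _ _ i] by blast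
  qed
  then show ?thesis by blast
qed

text \<open>Comparing b = d + e_j with d + e_i changes the exponent at i but not l. This needs b to
  have some support away from i, so the remaining obstacle is b = K e_i, which a second index and
  nondegeneracy remove.\<close>

lemma no_equality_beyond_1:
  assumes K: "1 \<le> K" "K + 2 \<le> rk n J" and "n \<ge> 2" and nondeg: "nondegenerate n J"
    and local: "\<And>b i. b \<in> J \<Longrightarrow> vec_size n b = K \<Longrightarrow> i \<in> Cont n J b \<Longrightarrow>
        local_weight b i = l \<and> b + unit_vec i + unit_vec i \<in> J"
  shows False
proof -
  have main: False if b: "b \<in> J" "vec_size n b = K" and i: "i \<in> Cont n J b" and j: "j \<noteq> i" "b j > 0" for b i j
  proof -
    obtain d where d: "b = d + unit_vec j" using j(2) by (rule obtain_minus_unit)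
    have "d + unit_vec i + unit_vec i + unit_vec j = b + unit_vec i + unit_vec i" by (simp add: d add_ac)
    then have dii: "d + unit_vec i + unit_vec i \<in> J" using local[OF b i] add_unit_downward by metis
    then have di: "d + unit_vec i \<in> J" by (rule add_unit_downward)
    have ij: "i \<in> {1..n}" "j \<in> {1..n}" using i b(1) unfolding d by (auto simp: Cont_def dest: add_unit_index)
    have "vec_size n (d + unit_vec i) = K" using b(2) ij by (simp add: d vec_size_add_unit)
    then have "local_weight (d + unit_vec i) i = local_weight b i"
      using local[OF di, of i] local[OF b i] dii mem_Cont by simp
    then have "t ^ Suc (d i) = t ^ d i"
      using weight_pos[OF ij(1)] j(1) by (simp add: local_weight_def d unit_vec_def plus_fun_apply)
    then show False using t_pos t_less_1 by simp
  qed
  have "vec_size n 0 = 0" by (simp add: vec_size_def zero_fun_apply)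
  then obtain b where b: "b \<in> J" "vec_size n b = K" using exists_of_size[OF zero_in_J, of K] K by auto
  obtain i where i: "i \<in> Cont n J b" using extend[OF b(1)] b(2) K by auto
  have i_range: "i \<in> {1..n}" using i by (auto simp: Cont_def)
  \<comment> \<open>\<open>f m\<close> is the multiple m e_i; by \<open>main\<close> the vector b
    has no support off i, hence is \<open>f K\<close>.\<close>
  define f where "f = (\<lambda>m l. if l = i then m else (0::nat))"
  have f_size: "vec_size n (f m) = m" for m using i_range by (simp add: vec_size_def f_def)
  have bf: "b = f K"
  proof
    fix l
    have zero: "b l = 0" if "l \<noteq> i" for l using main[OF b i that] by auto
    then have "vec_size n b = b i" using i_range by (simp add: vec_size_def sum.remove)
    then show "b l = f K l" using zero b(2) by (simp add: f_def)
  qed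
  obtain j where j: "j \<in> {1..n}" "j \<noteq> i"
    using \<open>n \<ge> 2\<close> by (cases "i = 1") (force intro: that[of 2], force intro: that[of 1])
  \<comment> \<open>Starting from e_j, repeated exchange against (K+2) e_i can only add e_i. The
    case m = K lets i be added to (K-1) e_i + e_j, to which \<open>main\<close> applies.\<close>
  have "f m + unit_vec j \<in> J" if "m \<le> K" for m
    using that
  proof (induction m)
    case 0
    have "f 0 + unit_vec j = unit_vec j" by (simp add: f_def fun_eq_iff plus_fun_apply)
    then show ?case using nondeg j(1) by (simp add: nondegenerate_def)
  next
    case (Suc m)
    have "b + unit_vec i + unit_vec i \<in> J" using local[OF b i] by simp
    moreover have "vec_size n (f m + unit_vec j) < vec_size n (b + unit_vec i + unit_vec i)"
      using Suc.prems b(2) i_range j(1) by (simp add: vec_size_add_unit f_size)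
    ultimately obtain l where l: "(f m + unit_vec j) l < (b + unit_vec i + unit_vec i) l" "f m + unit_vec j + unit_vec l \<in> J"
      using exchange Suc by (metis Suc_leD)
    then have "l = i" by (auto simp: bf f_def unit_vec_def plus_fun_apply split: if_splits)
    moreover have "f (Suc m) + unit_vec j = f m + unit_vec j + unit_vec i"
      by (simp add: fun_eq_iff plus_fun_apply f_def unit_vec_def)
    ultimately show ?case using l(2) by simp
  qed
  then have bj: "b + unit_vec j \<in> J" by (simp add: bf)
  have "b i > 0" using K by (simp add: bf f_def)
  then obtain d where d: "b = d + unit_vec i" by (rule obtain_minus_unit)
  have dji: "d + unit_vec j + unit_vec i \<in> J" using bj by (simp add: d add_ac)
  show False
  proof (rule main)
    show "d + unit_vec j \<in> J" using dji by (rule add_unit_downward)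
    show "vec_size n (d + unit_vec j) = K" using b(2) i_range j(1) by (simp add: d vec_size_add_unit)
    show "i \<in> Cont n J (d + unit_vec j)" using dji mem_Cont by blast
    show "j \<noteq> i" by (rule j)
    show "(d + unit_vec j) j > 0" by (simp add: unit_vec_def plus_fun_apply)
  qed
qed


section \<open>Iterated sums and the level sums of the statement\<close>

text \<open>The multinomial coefficient counts the orders of the m unit steps from b to a. In the
  induction a first step in direction i contributes the factor a_i - b_i, and these add up to m +
  1.\<close>

lemma ext_sum_explicit:
  "ext_sum m b = (\<Sum>a | a \<in> J \<and> b \<le> a \<and> vec_size n a = vec_size n b + m.
      fact m * weight a / (\<Prod>i\<in>{1..n}. fact (a i - b i)))"
proof (induction m arbitrary: b)
  case 0
  have "a = b" if "a \<in> J" "b \<le> a" "vec_size n a = vec_size n b" for a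
  proof
    fix i
    have "b \<in> J" using that hereditary by blast
    show "a i = b i"
    proof (cases "i \<in> {1..n}")
      case True
      show ?thesis
        using sum_mono_inv[of b "{1..n}" a i] that True by (auto simp: vec_size_def le_fun_def)
    next
      case False
      then show ?thesis using in_vectors[OF that(1)] in_vectors[OF \<open>b \<in> J\<close>] by (simp add: nat_vectors_def)
    qed
  qed
  then have "{a. a \<in> J \<and> b \<le> a \<and> vec_size n a = vec_size n b + 0} = (if b \<in> J then {b} else {})" by auto
  then show ?case by simp
next
  case (Suc m)
  define S where "S = {a. a \<in> J \<and> b \<le> a \<and> vec_size n a = vec_size n b + Suc m}"
  define P where "P = (\<lambda>a. \<Prod>i\<in>{1..n}. fact (a i - b i) :: real)"
  have fin: "finite S" using finite_J by (simp add: S_def)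
  have "ext_sum m (b + unit_vec i) = (\<Sum>a\<in>S. real (a i - b i) * (fact m * weight a / P a))" if i: "i \<in> {1..n}" for i
  proof -
    have set: "{a. a \<in> J \<and> b + unit_vec i \<le> a \<and> vec_size n a = vec_size n (b + unit_vec i) + m} = {a \<in> S. b i < a i}"
    proof -
      have "b + unit_vec i \<le> a \<longleftrightarrow> b \<le> a \<and> b i < a i" for a
      proof
        assume le: "b + unit_vec i \<le> a"
        have "b j + (if j = i then 1 else 0) \<le> a j" for j
          using le_funD[OF le, of j] by (simp add: plus_fun_apply unit_vec_def)
        then show "b \<le> a \<and> b i < a i" unfolding le_fun_def by (metis Suc_eq_plus1 Suc_le_lessD add_leD1)
      qed (auto simp: le_fun_def plus_fun_apply unit_vec_def Suc_le_eq)
      then show ?thesis using i by (auto simp: S_def vec_size_add_unit)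
    qed
    have "fact m * weight a / (\<Prod>j\<in>{1..n}. fact (a j - (b + unit_vec i) j)) = real (a i - b i) * (fact m * weight a / P a)"
      if "b i < a i" for a
    proof -
      have "P a = fact (a i - b i) * (\<Prod>j\<in>{1..n} - {i}. fact (a j - b j))"
        unfolding P_def using i by (simp add: prod.remove)
      also have "fact (a i - b i) = real (a i - b i) * fact (a i - (b + unit_vec i) i)"
        using that by (simp add: unit_vec_def plus_fun_apply fact_reduce)
      also have "(\<Prod>j\<in>{1..n} - {i}. fact (a j - b j)) = (\<Prod>j\<in>{1..n} - {i}. fact (a j - (b + unit_vec i) j) :: real)"
        by (intro prod.cong) (auto simp: unit_vec_def plus_fun_apply)
      finally have "P a = real (a i - b i) * (\<Prod>j\<in>{1..n}. fact (a j - (b + unit_vec i) j))"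
        using prod.remove[of "{1..n}" i "\<lambda>j. fact (a j - (b + unit_vec i) j) :: real"] i
        by (simp only: mult.assoc finite_atLeastAtMost)
      then show ?thesis using that by simp
    qed
    then have "ext_sum m (b + unit_vec i) = (\<Sum>a\<in>{a \<in> S. b i < a i}. real (a i - b i) * (fact m * weight a / P a))"
      unfolding Suc.IH set by (intro sum.cong) auto
    also have "\<dots> = (\<Sum>a\<in>S. real (a i - b i) * (fact m * weight a / P a))"
      using fin by (intro sum.mono_neutral_left) auto
    finally show ?thesis .
  qed
  then have "ext_sum (Suc m) b = (\<Sum>i\<in>{1..n}. \<Sum>a\<in>S. real (a i - b i) * (fact m * weight a / P a))"
    unfolding ext_sum.simps by (rule sum.cong[OF refl])
  also have "\<dots> = (\<Sum>a\<in>S. (\<Sum>i\<in>{1..n}. real (a i - b i)) * (fact m * weight a / P a))"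
    by (subst sum.swap) (simp only: sum_distrib_right)
  also have "\<dots> = (\<Sum>a\<in>S. fact (Suc m) * weight a / P a)"
  proof (intro sum.cong refl)
    fix a assume a: "a \<in> S"
    have "(\<Sum>i\<in>{1..n}. a i - b i) = Suc m"
      using a by (simp add: S_def vec_size_def le_fun_def sum_subtractf_nat)
    then have "(\<Sum>i\<in>{1..n}. real (a i - b i)) = real (Suc m)" by (metis of_nat_sum)
    then show "(\<Sum>i\<in>{1..n}. real (a i - b i)) * (fact m * weight a / P a) = fact (Suc m) * weight a / P a"
      by (simp add: mult.assoc)
  qed
  finally show ?case by (simp add: S_def P_def)
qed

lemma ext_sum_zero: "ext_sum m 0 = fact m * weighted_level_sum n J \<omega> t m"
proof -
  have "{a. a \<in> J \<and> 0 \<le> a \<and> vec_size n a = vec_size n 0 + m} = level n J m"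
    by (auto simp: level_def vec_size_def le_fun_def zero_fun_apply)
  then show ?thesis
    unfolding ext_sum_explicit weighted_level_sum_def
    by (simp add: zero_fun_apply weight_def vec_fact_def sum_distrib_left)
qed

end

section \<open>Polygirth and the parallel classes at the origin\<close>

text \<open>Stars and bars, carried over from lists; coordinate i sits at list position i -
  1.\<close>

lemma card_nat_vectors_of_size:
  "card {a \<in> nat_vectors n. vec_size n a = m} = (n + m - 1) choose m"
  "finite {a \<in> nat_vectors n. vec_size n a = m}"
proof -
  have size: "sum_list (map a [1..<Suc n]) = vec_size n a" for a
    by (simp add: vec_size_def sum_list_distinct_conv_sum_set atLeastLessThanSuc_atLeastAtMost del: upt_Suc)
  have bij: "bij_betw (\<lambda>a. map a [1..<Suc n]) {a \<in> nat_vectors n. vec_size n a = m}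
      {l. length l = n \<and> sum_list l = m}"
  proof (rule bij_betw_byWitness[where f' = "\<lambda>l i. if i \<in> {1..n} then l ! (i - 1) else 0"])
    have inv: "map (\<lambda>i. if i \<in> {1..n} then l ! (i - 1) else 0) [1..<Suc n] = l" if "length l = n" for l :: "nat list"
      using that by (intro nth_equalityI) (auto simp del: upt_Suc)
    then show "\<forall>l\<in>{l. length l = n \<and> sum_list l = m}.
        map (\<lambda>i. if i \<in> {1..n} then l ! (i - 1) else 0) [1..<Suc n] = l" by blast
    show "\<forall>a\<in>{a \<in> nat_vectors n. vec_size n a = m}.
        (\<lambda>i. if i \<in> {1..n} then map a [1..<Suc n] ! (i - 1) else 0) = a"
      by (auto simp: nat_vectors_def fun_eq_iff simp del: upt_Suc)
    show "(\<lambda>a. map a [1..<Suc n]) ` {a \<in> nat_vectors n. vec_size n a = m} \<subseteq> {l. length l = n \<and> sum_list l = m}"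
      by (auto simp: size simp del: upt_Suc One_nat_def)
    show "(\<lambda>l i. if i \<in> {1..n} then l ! (i - 1) else 0) ` {l. length l = n \<and> sum_list l = m}
        \<subseteq> {a \<in> nat_vectors n. vec_size n a = m}"
    proof (intro image_subsetI CollectI conjI)
      fix l :: "nat list" assume l: "l \<in> {l. length l = n \<and> sum_list l = m}"
      let ?a = "\<lambda>i. if i \<in> {1..n} then l ! (i - 1) else 0"
      show "?a \<in> nat_vectors n" by (simp add: nat_vectors_def)
      have "map ?a [1..<Suc n] = l" using l by (intro inv) blast
      then have "vec_size n ?a = sum_list l" using size[of ?a] by (simp only:)
      then show "vec_size n ?a = m" using l by simp
    qed
  qed
  show "card {a \<in> nat_vectors n. vec_size n a = m} = (n + m - 1) choose m"
    using bij_betw_same_card[OF bij] card_length_sum_list[of n m] by (simp add: add.commute)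
  have "{l. length l = n \<and> sum_list l = m} \<subseteq> {l. set l \<subseteq> {0..m} \<and> length l = n}"
    using member_le_sum_list by (fastforce simp: subset_iff)
  then have "finite {l :: nat list. length l = n \<and> sum_list l = m}"
    using finite_lists_length_eq[of "{0..m}" n] finite_subset by blast
  then show "finite {a \<in> nat_vectors n. vec_size n a = m}" using bij_betw_finite[OF bij] by blast
qed

context polymatroid
begin

lemma less_polygirth_iff:
  assumes "n \<ge> 1"
  shows "polygirth n J > m \<longleftrightarrow> (\<forall>a\<in>nat_vectors n. vec_size n a \<le> m \<longrightarrow> a \<in> J)"
proof -
  let ?V = "\<lambda>k. {a \<in> nat_vectors n. vec_size n a = k}"
  have sub: "level n J k \<subseteq> ?V k" for k using in_vectors by (auto simp: level_def)
  have full: "card (level n J k) < (n + k - 1) choose k \<longleftrightarrow> level n J k \<noteq> ?V k" for k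
    using sub[of k] card_nat_vectors_of_size[of n k] psubset_card_mono[of "?V k" "level n J k"] by auto
  \<comment> \<open>The least element exists: above the rank the level is empty, while for n >= 1
    the binomial coefficient is positive.\<close>
  have ex: "card (level n J (Suc (rk n J))) < (n + Suc (rk n J) - 1) choose Suc (rk n J)"
  proof -
    have "vec_size n a \<le> rk n J" if "a \<in> J" for a using that finite_J by (simp add: rk_def)
    then have "level n J (Suc (rk n J)) = {}" by (force simp: level_def)
    then show ?thesis using assms by simp
  qed
  have "polygirth n J > m \<longleftrightarrow> (\<forall>k\<le>m. level n J k = ?V k)"
  proof
    assume "polygirth n J > m"
    then show "\<forall>k\<le>m. level n J k = ?V k"
      using not_less_Least[of _ "\<lambda>k. card (level n J k) < (n + k - 1) choose k"] full
      unfolding polygirth_def by (meson le_less_trans)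
  next
    assume *: "\<forall>k\<le>m. level n J k = ?V k"
    have "card (level n J (polygirth n J)) < (n + polygirth n J - 1) choose polygirth n J"
      unfolding polygirth_def by (rule LeastI) (rule ex)
    then show "polygirth n J > m" using * full by (meson not_le)
  qed
  also have "\<dots> \<longleftrightarrow> (\<forall>a\<in>nat_vectors n. vec_size n a \<le> m \<longrightarrow> a \<in> J)"
    using in_vectors by (auto simp: level_def)
  finally show ?thesis .
qed

text \<open>Every vector of size two is a sum of two unit vectors, and smaller sizes follow by
  heredity. The right side is what the equality analysis at b = 0 delivers.\<close>

lemma less_polygirth_2_iff:
  assumes "n \<ge> 1"
  shows "polygirth n J > 2 \<longleftrightarrow> (\<forall>i\<in>{1..n}. \<forall>j\<in>{1..n}. unit_vec i + unit_vec j \<in> J)"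
proof
  assume "polygirth n J > 2"
  then have *: "\<And>a. a \<in> nat_vectors n \<Longrightarrow> vec_size n a \<le> 2 \<Longrightarrow> a \<in> J"
    using less_polygirth_iff[OF assms] by blast
  have "unit_vec i + unit_vec j \<in> nat_vectors n" "vec_size n (unit_vec i + unit_vec j) = 2"
    if "i \<in> {1..n}" "j \<in> {1..n}" for i j
    using that by (auto simp: nat_vectors_def unit_vec_def plus_fun_apply vec_size_def sum.distrib)
  then show "\<forall>i\<in>{1..n}. \<forall>j\<in>{1..n}. unit_vec i + unit_vec j \<in> J" using * by simp
next
  assume *: "\<forall>i\<in>{1..n}. \<forall>j\<in>{1..n}. unit_vec i + unit_vec j \<in> J"
  have step: "\<exists>d\<in>nat_vectors n. \<exists>i\<in>{1..n}. a = d + unit_vec i \<and> vec_size n a = Suc (vec_size n d)"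
    if a: "a \<in> nat_vectors n" "vec_size n a > 0" for a
  proof -
    obtain i where i: "i \<in> {1..n}" "a i > 0"
      using a(2) by (metis less_irrefl neq0_conv sum.neutral vec_size_def)
    have "a = a(i := a i - 1) + unit_vec i" using i(2) by (auto simp: unit_vec_def plus_fun_apply)
    moreover from this have "vec_size n a = Suc (vec_size n (a(i := a i - 1)))"
      using vec_size_add_unit[OF i(1), of "a(i := a i - 1)"] by simp
    moreover have "a(i := a i - 1) \<in> nat_vectors n" using a(1) i(1) by (auto simp: nat_vectors_def)
    ultimately show ?thesis using i(1) by blast
  qed
  have zero: "a = 0" if "a \<in> nat_vectors n" "vec_size n a = 0" for a
    using that by (fastforce simp: nat_vectors_def vec_size_def zero_fun_apply)
  have unit: "unit_vec i \<in> J" if "i \<in> {1..n}" for i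
    using * that add_unit_downward by blast
  have "a \<in> J" if a: "a \<in> nat_vectors n" "vec_size n a \<le> 2" for a
  proof (cases "vec_size n a = 0")
    case True
    then show ?thesis using zero a zero_in_J by blast
  next
    case False
    then obtain d i where d: "d \<in> nat_vectors n" "i \<in> {1..n}" "a = d + unit_vec i" "vec_size n a = Suc (vec_size n d)"
      using step a by blast
    show ?thesis
    proof (cases "vec_size n d = 0")
      case True
      then have "d = 0" using zero d(1) by blast
      then show ?thesis using unit d by simp
    next
      case False
      then obtain e j where e: "e \<in> nat_vectors n" "j \<in> {1..n}" "d = e + unit_vec j" "vec_size n d = Suc (vec_size n e)"
        using step d(1) by blast
      then have "e = 0" using zero a d(4) by simp
      then show ?thesis using * d e by simp
    qed
  qed
  then show "polygirth n J > 2" using less_polygirth_iff[OF assms] by blast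
qed

lemma Par_zero_discrete:
  assumes "\<forall>i\<in>{1..n}. \<forall>j\<in>{1..n}. unit_vec i + unit_vec j \<in> J"
  shows "Cont n J 0 = {1..n}" "max_par n J 0 = n"
proof -
  show C: "Cont n J 0 = {1..n}" using assms add_unit_downward by (auto simp: Cont_def)
  have "par_rel n J 0 `` {i} = {i}" if "i \<in> {1..n}" for i
    using that assms by (auto simp: par_rel_def C)
  then have "Par n J 0 = (\<lambda>i. {i}) ` {1..n}" by (auto simp: Par_def quotient_def C)
  then have "card (Par n J 0) = n" by (simp add: card_image)
  moreover have "level n J 0 = {0}"
    using zero_in_J vec_size_eq_zero by (auto simp: level_def) (auto simp: vec_size_def zero_fun_apply)
  ultimately show "max_par n J 0 = n" by (simp add: max_par_def)
qed

end

text \<open>The hypothesis \<open>n \<ge> 2 \<or> k = 1\<close> excludes a genuine exception. For n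
  = 1 each level is a single monomial and p = 1, so the constant is (1 + 1/k) / t, and the exponents
  of t satisfy C(k-1,2) + C(k+1,2) = 2 C(k,2) + 1: equality then holds for every k below the rank,
  also for k >= 2.\<close>

theorem theorem1p24:
  fixes n k :: nat
    and J :: "(nat \<Rightarrow> nat) set"
    and \<omega> :: "nat \<Rightarrow> real"
    and t :: real
  assumes "discrete_polymatroid n J"
    and "nondegenerate n J"
    and "\<And>i. i \<in> {1..n} \<Longrightarrow> \<omega> i > 0"
    and "1 \<le> k" and "k < rk n J"
    and "0 < t" and "t < 1"
    and "n \<ge> 2 \<or> k = 1"
  shows "(weighted_level_sum n J \<omega> t k)\<^sup>2 =
           (1 + 1 / real k) * (1 + (1 - t) / (real (max_par n J (k - 1)) - 1 + t)) *
           weighted_level_sum n J \<omega> t (k - 1) * weighted_level_sum n J \<omega> t (k + 1)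
         \<longleftrightarrow> k = 1 \<and> polygirth n J > 2 \<and> uniform_weight n \<omega>"
proof -
  interpret weighted_polymatroid n J \<omega> t
    using assms by unfold_locales auto
  define K where "K = k - 1"
  have k: "k = K + 1" "K + 2 \<le> rk n J" using assms(4,5) by (simp_all add: K_def)
  define p where "p = real (max_par n J K)"
  define q where "q = 1 + (1 - t) / (p - 1 + t)"
  have "p \<ge> 1"
  proof -
    have "vec_size n 0 = 0" by (simp add: vec_size_def zero_fun_apply)
    then obtain b where b: "b \<in> J" "vec_size n b = K" using exists_of_size[OF zero_in_J, of K] k by auto
    then have "card (Par n J b) > 0" using card_Par_pos[of b] k by simp
    then show ?thesis using card_Par_le[OF b(1)] b(2) by (simp add: p_def)
  qed
  then have p: "p > 0" "p - 1 + t > 0" using assms(6) by simp_all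
  have q: "q = p / (p - 1 + t)" "q * (1 - (1 - t) / p) = 1"
  proof -
    have "q = (p - 1 + t) / (p - 1 + t) + (1 - t) / (p - 1 + t)" using p by (simp add: q_def)
    then show *: "q = p / (p - 1 + t)" unfolding add_divide_distrib[symmetric] by simp
    have "1 - (1 - t) / p = (p - 1 + t) / p" using p by (simp add: field_simps)
    then show "q * (1 - (1 - t) / p) = 1" unfolding * using p by simp
  qed
  define W where "W = weighted_level_sum n J \<omega> t"
  have "(W k)\<^sup>2 = (1 + 1 / real k) * q * W (k - 1) * W (k + 1)
    \<longleftrightarrow> (ext_sum (K + 1) 0)\<^sup>2 = q * ext_sum K 0 * ext_sum (K + 2) 0" (is "?L \<longleftrightarrow> _")
  proof -
    \<comment> \<open>The factorials K! (K+2)! equal (K+1)!^2 (1 + 1/k), which absorbs the factor 1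
      + 1/k of the statement.\<close>
    have "q * ext_sum K 0 * ext_sum (K + 2) 0 = (fact K)\<^sup>2 * (real (K + 1) * real (K + 2)) * (q * W K * W (K + 2))"
      by (simp add: ext_sum_zero W_def power2_eq_square algebra_simps del: ext_sum.simps)
    also have "real (K + 1) * real (K + 2) = (real (K + 1))\<^sup>2 * (1 + 1 / real k)"
      by (simp add: k power2_eq_square field_simps)
    also have "(fact K)\<^sup>2 * ((real (K + 1))\<^sup>2 * (1 + 1 / real k)) * (q * W K * W (K + 2))
       = (fact (K + 1))\<^sup>2 * ((1 + 1 / real k) * q * W (k - 1) * W (k + 1))"
      by (simp add: k power2_eq_square)
    finally have "q * ext_sum K 0 * ext_sum (K + 2) 0 = (fact (K + 1))\<^sup>2 * ((1 + 1 / real k) * q * W (k - 1) * W (k + 1))" .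
    moreover have "(ext_sum (K + 1) 0)\<^sup>2 = (fact (K + 1))\<^sup>2 * (W k)\<^sup>2"
      unfolding ext_sum_zero by (simp only: W_def k power_mult_distrib)
    ultimately show ?thesis by (simp only: mult_cancel_left power_eq_0_iff fact_nonzero) simp
  qed
  also have "\<dots> \<longleftrightarrow> k = 1 \<and> polygirth n J > 2 \<and> uniform_weight n \<omega>"
  proof
    assume "(ext_sum (K + 1) 0)\<^sup>2 = q * ext_sum K 0 * ext_sum (K + 2) 0"
    then obtain l where l: "\<And>b i. b \<in> J \<Longrightarrow> vec_size n b = K \<Longrightarrow> i \<in> Cont n J b \<Longrightarrow>
        local_weight b i = l \<and> (\<forall>j\<in>Cont n J b. b + unit_vec i + unit_vec j \<in> J)"
      using equality_local[OF k(2) p_def q(2)] by blast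
    have "K = 0"
    proof (rule ccontr)
      assume "K \<noteq> 0"
      then have "1 \<le> K" "n \<ge> 2" using assms(8) k by auto
      then show False
      proof (rule no_equality_beyond_1[OF _ k(2) _ assms(2)])
        fix b i assume "b \<in> J" "vec_size n b = K" "i \<in> Cont n J b"
        then show "local_weight b i = l \<and> b + unit_vec i + unit_vec i \<in> J" using l by blast
      qed
    qed
    have C: "Cont n J 0 = {1..n}"
      using assms(2) by (auto simp: Cont_def nondegenerate_def)
    \<comment> \<open>With K = 0 the only vector is b = 0, where \<open>local_weight 0 i\<close> is
      the plain weight of i; a common l thus means uniformity.\<close>
    have "vec_size n 0 = K" by (simp add: vec_size_def zero_fun_apply \<open>K = 0\<close>)
    from l[OF zero_in_J this, unfolded C]
    have *: "\<forall>i\<in>{1..n}. \<omega> i = l" "\<forall>i\<in>{1..n}. \<forall>j\<in>{1..n}. unit_vec i + unit_vec j \<in> J"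
      by (auto simp: local_weight_def zero_fun_apply)
    have "n \<ge> 1" using extend[OF zero_in_J] k \<open>vec_size n 0 = K\<close> C by fastforce
    then show "k = 1 \<and> polygirth n J > 2 \<and> uniform_weight n \<omega>"
      using * k \<open>K = 0\<close> less_polygirth_2_iff by (auto simp: uniform_weight_def)
  next
    assume rhs: "k = 1 \<and> polygirth n J > 2 \<and> uniform_weight n \<omega>"
    then have K: "K = 0" using k by simp
    obtain c where c: "\<forall>i\<in>{1..n}. \<omega> i = c" using rhs by (auto simp: uniform_weight_def)
    have "vec_size n 0 < rk n J" using k(2) by (simp add: vec_size_def zero_fun_apply)
    then obtain i where "i \<in> Cont n J 0" using extend[OF zero_in_J] by blast
    then have n: "n \<ge> 1" by (auto simp: Cont_def)
    then have pairs: "\<forall>i\<in>{1..n}. \<forall>j\<in>{1..n}. unit_vec i + unit_vec j \<in> J"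
      using rhs less_polygirth_2_iff by blast
    \<comment> \<open>All classes at the origin are singletons, so p(0) = n and the three sums are
      1, n c and n c^2 (n - 1 + t), which match q = n / (n - 1 + t).\<close>
    note Par_zero_discrete[OF pairs]
    then have C: "Cont n J 0 = {1..n}" and pn: "p = real n" by (simp_all add: p_def K)
    have w0: "weight 0 = 1" by (simp add: weight_def pair_count_def weight_monom_def zero_fun_apply binomial_eq_0)
    have lw: "local_weight 0 i = c" if "i \<in> {1..n}" for i
      using c that by (simp add: local_weight_def zero_fun_apply)
    have e1: "ext_sum 1 0 = real n * c"
      unfolding ext_sum_1[OF zero_in_J] w0 C by (simp add: lw)
    have "pair_form 0 (local_weight 0) = (\<Sum>i\<in>{1..n}. \<Sum>j\<in>{1..n}. c\<^sup>2 + (if i = j then c\<^sup>2 * (t - 1) else 0))"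
      unfolding pair_form_def C using pairs
      by (intro sum.cong refl) (simp add: lw power2_eq_square algebra_simps)
    also have "\<dots> = (\<Sum>i\<in>{1..n}. real n * c\<^sup>2 + c\<^sup>2 * (t - 1))"
      by (intro sum.cong refl) (simp add: sum.distrib)
    also have "\<dots> = real n * c\<^sup>2 * (real n - 1 + t)" by (simp add: algebra_simps)
    finally have e2: "ext_sum 2 0 = real n * c\<^sup>2 * (real n - 1 + t)"
      unfolding ext_sum_2[OF zero_in_J] w0 by simp
    have e0: "ext_sum 0 0 = 1" using zero_in_J w0 by simp
    have d: "real n - 1 + t > 0" using n assms(6) by linarith
    have "q * 1 * (real n * c\<^sup>2 * (real n - 1 + t))
        = real n * (real n * c\<^sup>2) * ((real n - 1 + t) / (real n - 1 + t))"
      unfolding q(1) pn by (simp only: times_divide_eq_left times_divide_eq_right mult_1_right mult.assoc)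
    also have "\<dots> = (real n * c)\<^sup>2" using d by (simp add: power2_eq_square)
    finally have "(real n * c)\<^sup>2 = q * 1 * (real n * c\<^sup>2 * (real n - 1 + t))" ..
    then show "(ext_sum (K + 1) 0)\<^sup>2 = q * ext_sum K 0 * ext_sum (K + 2) 0"
      unfolding K add_0 e0 e1 e2 .
  qed
  finally show ?thesis by (simp add: W_def q_def p_def K_def)
qed

end
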